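(* Consider the asynchronous $Q$-learning iterates $Q(t)$ on a single trajectory generated by a behavioral policy $\pi$ in a $\gamma$-discounted finite MDP, as described in the context, with $\gamma\in(0,1)$. Suppose: (a) $|r_t|\le\bar r$ almost surely for all $t$; (b) under $\pi$, the induced Markov chain with state $(s_t,a_t)$ is ergodic, with stationary distribution $\mu$ and mixing time $t_{\mathrm{mix}}$, and $\mu_{\min}:=\inf_{s,a}\mu_{s,a}>0$. Let the step size be $\alpha_t=\frac{h}{t+t_0}$ with $t_0\ge\max\left(4h,\lceil\log_2\frac{2}{\mu_{\min}}\rceil t_{\mathrm{mix}}\right)$ and $h\ge\frac{4}{\mu_{\min}(1-\gamma)}$. Then for every integer $T\ge1$ and every $\delta\in(0,1)$, with probability at least $1-\delta$, $$\begin{aligned}\|Q(T)-Q^*\|_\infty\le{}&\frac{60\bar r}{(1-\gamma)^2}\sqrt{\frac{2\left(\lceil\log_2\frac{2}{\mu_{\min}}\rceil t_{\mathrm{mix}}+1\right)h}{\mu_{\min}}}\sqrt{\frac{\log\left(\frac{2\left(\lceil\log_2\frac{2}{\mu_{\min}}\rceil t_{\mathrm{mix}}+1\right)T^2|\mathcal S||\mathcal A|}{\delta}\right)}{T+t_0}}\\&+\frac{4\bar r}{(1-\gamma)^2}\max\left(\frac{160h\lceil\log_2\frac{2}{\mu_{\min}}\rceil t_{\mathrm{mix}}}{\mu_{\min}},\,2\left(\lceil\log_2\tfrac{2}{\mu_{\min}}\rceil t_{\mathrm{mix}}+t_0\right)\right)\frac{1}{T+t_0}.\end{aligned}$$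
   Context: An MDP has finite state space $\mathcal S$, finite action space $\mathcal A$, transition probabilities $\mathbb P(s'\mid s,a)$, and discount factor $\gamma$. At time $t$, given the history up to and including $(s_t,a_t)$, the reward $r_t$ is drawn independently from a fixed distribution depending only on $(s_t,a_t)$, with mean $r_{s_t,a_t}$, where $r\in\mathbb R^{\mathcal S\times\mathcal A}$ is a deterministic vector; the next state is $s_{t+1}\sim\mathbb P(\cdot\mid s_t,a_t)$. A policy $\pi$ maps states to probability distributions on $\mathcal A$; under $\pi$, $a_t\sim\pi(\cdot\mid s_t)$. The $Q$-function of $\pi$ is $Q^\pi_{s,a}=\mathbb E_\pi[\sum_{t\ge0}\gamma^tr_t\mid(s_0,a_0)=(s,a)]$. The optimal $Q$-function $Q^*$ is the $Q$-function of an optimal policy (one maximizing $Q^\pi_{s,a}$ simultaneously for all $(s,a)$); equivalently, it is the unique fixed point of the Bellman operator $F:\mathbb R^{\mathcal S\times\mathcal A}\to\mathbb R^{\mathcal S\times\mathcal A}$, $$F_{s,a}(Q)=r_{s,a}+\gamma\,\mathbb E_{s'\sim\mathbb P(\cdot\mid s,a)}\max_{a'\in\mathcal A}Q_{s',a'}.$$ Asynchronous $Q$-learning: a trajectory $\{(s_t,a_t,r_t)\}_{t\ge0}$ is sampled using a behavioral policy $\pi$; $Q(0)$ is the all-zero table, and $$Q_{s_t,a_t}(t+1)=(1-\alpha_t)Q_{s_t,a_t}(t)+\alpha_t\big[r_t+\gamma\max_{a\in\mathcal A}Q_{s_{t+1},a}(t)\big],\qquad Q_{s,a}(t+1)=Q_{s,a}(t)\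 \text{ for }(s,a)\ne(s_t,a_t).$$ $\|\cdot\|_\infty$ is the standard infinity norm on $\mathbb R^{\mathcal S\times\mathcal A}$. Ergodic means irreducible and aperiodic. The mixing time $t_{\mathrm{mix}}$ is the smallest positive integer $t$ such that, from every initial state of the chain, the distribution after $t$ steps is within total variation distance $1/4$ of $\mu$. *)

theory Defs
  imports "HOL-Probability.Probability"
begin

text \<open>
  Throughout, \<open>P (s, a)\<close> is the distribution of the next state, \<open>R (s, a)\<close> the distribution of the
  reward, \<open>\<gamma>\<close> the discount factor, and a policy maps each state to a distribution on the actions.
  A trajectory is a sequence of triples \<open>((s\<^sub>t, a\<^sub>t), r\<^sub>t)\<close>.
\<close>

definition with_action :: "('s \<Rightarrow> 'a pmf) \<Rightarrow> 's pmf \<Rightarrow> ('s \<times> 'a) pmf" where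
  "with_action \<pi> p = bind_pmf p (\<lambda>s. map_pmf (Pair s) (\<pi> s))"

definition sa_kernel ::
  "('s \<times> 'a \<Rightarrow> 's pmf) \<Rightarrow> ('s \<Rightarrow> 'a pmf) \<Rightarrow> 's \<times> 'a \<Rightarrow> ('s \<times> 'a) pmf" where
  "sa_kernel P \<pi> x = with_action \<pi> (P x)"

abbreviation step_space :: "('x \<times> real) measure" where
  "step_space \<equiv> count_space UNIV \<Otimes>\<^sub>M borel"

definition with_reward :: "('x \<Rightarrow> real measure) \<Rightarrow> 'x pmf \<Rightarrow> ('x \<times> real) measure" where
  "with_reward R p = measure_pmf p \<bind> (\<lambda>x. distr (R x) step_space (Pair x))"

text \<open>
  The conditional law of the step at time \<open>t\<close> given the history \<open>\<omega>\<close> of all earlier steps, rewards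
  included; \<open>p\<close> is the law of \<open>(s\<^sub>0, a\<^sub>0)\<close>.
\<close>

definition step_law ::
  "('x \<Rightarrow> real measure) \<Rightarrow> ('x \<Rightarrow> 'x pmf) \<Rightarrow> 'x pmf \<Rightarrow> nat \<Rightarrow> (nat \<Rightarrow> 'x \<times> real) \<Rightarrow> ('x \<times> real) measure"
  where
  "step_law R K p t \<omega> = with_reward R (if t = 0 then p else K (fst (\<omega> (t - 1))))"

text \<open>
  The Ionescu-Tulcea measure with these conditional laws. It is meaningful because the locale
  assumptions hold as soon as each \<open>R x\<close> is a probability measure on the Borel sets; see
  \<open>Ionescu_Tulcea_step_law\<close> below.
\<close>

definition traj_law ::
  "('x \<Rightarrow> real measure) \<Rightarrow> ('x \<Rightarrow> 'x pmf) \<Rightarrow> 'x pmf \<Rightarrow> (nat \<Rightarrow> 'x \<times> real) measure" where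
  "traj_law R K p =
     projective_family.lim UNIV (Ionescu_Tulcea.CI (step_law R K p) (\<lambda>_. step_space)) (\<lambda>_. step_space)"

lemma with_reward_in_prob_algebra:
  fixes R :: "'x \<Rightarrow> real measure"
  assumes "\<And>x. prob_space (R x)" "\<And>x. sets (R x) = sets borel"
  shows "with_reward R p \<in> space (prob_algebra step_space)"
proof -
  have R: "R x \<in> space (prob_algebra borel)" for x
    using assms by (simp add: space_prob_algebra)
  have "distr (R x) step_space (Pair x) \<in> space (prob_algebra step_space)" for x
    using R[of x] by (intro measurable_space[OF measurable_distr_prob_space]) simp_all
  then have "(\<lambda>x. distr (R x) step_space (Pair x)) \<in> count_space UNIV \<rightarrow>\<^sub>M prob_algebra step_space"
    by simp
  moreover have "measure_pmf p \<in> space (prob_algebra (count_space UNIV))"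
    by (simp add: space_prob_algebra prob_space_measure_pmf)
  ultimately have "(\<lambda>_. with_reward R p) \<in> count_space (UNIV :: unit set) \<rightarrow>\<^sub>M prob_algebra step_space"
    unfolding with_reward_def
    by (intro measurable_bind_prob_space[where N = "count_space UNIV"]) simp_all
  then show ?thesis
    by (auto simp: Pi_iff)
qed

lemma Ionescu_Tulcea_step_law:
  fixes R :: "'x \<Rightarrow> real measure"
  assumes R: "\<And>x. prob_space (R x)" "\<And>x. sets (R x) = sets borel"
  shows "Ionescu_Tulcea (step_law R K p) (\<lambda>_. step_space)"
proof (rule Ionescu_Tulcea.intro)
  note wr = with_reward_in_prob_algebra[of R, OF R]
  show "step_law R K p i \<in> PiM {0..<i} (\<lambda>_. step_space) \<rightarrow>\<^sub>M subprob_algebra step_space" for i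
  proof (cases "i = 0")
    case True
    then show ?thesis
      using wr[of p] by (auto simp: step_law_def[abs_def] intro!: measurable_prob_algebraD)
  next
    case False
    have [measurable]: "(\<lambda>x. with_reward R (K x)) \<in> count_space UNIV \<rightarrow>\<^sub>M prob_algebra step_space"
      using wr by simp
    have [measurable]: "(\<lambda>\<omega>. fst (\<omega> (i - 1))) \<in> PiM {0..<i} (\<lambda>_. step_space :: ('x \<times> real) measure) \<rightarrow>\<^sub>M count_space UNIV"
      using False
      by (intro measurable_compose[where f = "\<lambda>\<omega>. \<omega> (i - 1)" and g = fst and N = step_space]
          measurable_component_singleton) auto
    have "(\<lambda>\<omega>. with_reward R (K (fst (\<omega> (i - 1))))) \<in> PiM {0..<i} (\<lambda>_. step_space) \<rightarrow>\<^sub>M prob_algebra step_space"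
      by measurable
    then show ?thesis
      using False by (auto simp: step_law_def[abs_def] intro!: measurable_prob_algebraD)
  qed
  show "prob_space (step_law R K p i \<omega>)" if "\<omega> \<in> space (PiM {0..<i} (\<lambda>_. step_space))" for i \<omega>
    using wr by (simp add: step_law_def space_prob_algebra)
qed

definition q_fun ::
  "('s::finite \<times> 'a::finite \<Rightarrow> 's pmf) \<Rightarrow> ('s \<times> 'a \<Rightarrow> real measure) \<Rightarrow> real \<Rightarrow> ('s \<Rightarrow> 'a pmf) \<Rightarrow> real ^ ('s \<times> 'a)" where
  "q_fun P R \<gamma> \<pi> =
     (\<chi> x. \<integral>\<omega>. (\<Sum>t. \<gamma> ^ t * snd (\<omega> t)) \<partial>traj_law R (sa_kernel P \<pi>) (return_pmf x))"

definition optimal_policy ::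
  "('s::finite \<times> 'a::finite \<Rightarrow> 's pmf) \<Rightarrow> ('s \<times> 'a \<Rightarrow> real measure) \<Rightarrow> real \<Rightarrow> ('s \<Rightarrow> 'a pmf) \<Rightarrow> bool" where
  "optimal_policy P R \<gamma> \<rho> \<longleftrightarrow> (\<forall>\<pi> x. q_fun P R \<gamma> \<pi> $ x \<le> q_fun P R \<gamma> \<rho> $ x)"

text \<open>The iterates of asynchronous Q-learning along the trajectory \<open>\<omega>\<close>.\<close>

primrec q_iter ::
  "real \<Rightarrow> (nat \<Rightarrow> real) \<Rightarrow> (nat \<Rightarrow> ('s::finite \<times> 'a::finite) \<times> real) \<Rightarrow> nat \<Rightarrow> real ^ ('s \<times> 'a)" where
  "q_iter \<gamma> \<alpha> \<omega> 0 = 0"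
| "q_iter \<gamma> \<alpha> \<omega> (Suc t) =
     (let Q = q_iter \<gamma> \<alpha> \<omega> t; (x, r) = \<omega> t; s' = fst (fst (\<omega> (Suc t)))
      in \<chi> y. if y = x then (1 - \<alpha> t) * Q $ x + \<alpha> t * (r + \<gamma> * (MAX a. Q $ (s', a))) else Q $ y)"

primrec nstep :: "('x \<Rightarrow> 'x pmf) \<Rightarrow> nat \<Rightarrow> 'x \<Rightarrow> 'x pmf" where
  "nstep K 0 x = return_pmf x"
| "nstep K (Suc n) x = bind_pmf (nstep K n x) K"

definition irreducible_chain :: "('x \<Rightarrow> 'x pmf) \<Rightarrow> bool" where
  "irreducible_chain K \<longleftrightarrow> (\<forall>x y. \<exists>n. pmf (nstep K n x) y > 0)"

definition aperiodic_chain :: "('x \<Rightarrow> 'x pmf) \<Rightarrow> bool" where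
  "aperiodic_chain K \<longleftrightarrow> (\<forall>x. Gcd {n. n > 0 \<and> pmf (nstep K n x) x > 0} = 1)"

definition ergodic_chain :: "('x \<Rightarrow> 'x pmf) \<Rightarrow> bool" where
  "ergodic_chain K \<longleftrightarrow> irreducible_chain K \<and> aperiodic_chain K"

definition stationary :: "('x \<Rightarrow> 'x pmf) \<Rightarrow> 'x pmf \<Rightarrow> bool" where
  "stationary K \<mu> \<longleftrightarrow> bind_pmf \<mu> K = \<mu>"

definition tv_dist :: "'x pmf \<Rightarrow> 'x pmf \<Rightarrow> real" where
  "tv_dist p q = (SUP A. \<bar>measure_pmf.prob p A - measure_pmf.prob q A\<bar>)"

definition mixed_at :: "('x \<Rightarrow> 'x pmf) \<Rightarrow> 'x pmf \<Rightarrow> nat \<Rightarrow> bool" where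
  "mixed_at K \<mu> t \<longleftrightarrow> (\<forall>x. tv_dist (nstep K t x) \<mu> \<le> 1 / 4)"

definition is_mixing_time :: "('x \<Rightarrow> 'x pmf) \<Rightarrow> 'x pmf \<Rightarrow> nat \<Rightarrow> bool" where
  "is_mixing_time K \<mu> t \<longleftrightarrow> t > 0 \<and> mixed_at K \<mu> t \<and> (\<forall>t'. 0 < t' \<and> t' < t \<longrightarrow> \<not> mixed_at K \<mu> t')"

end

theory Submission
  imports Defs
begin

text \<open>
  Write \<open>F\<close> for the Bellman operator, \<open>\<sigma> = \<mu>_min / 2\<close> and \<open>\<tau> = \<lceil>log 2 (2 / \<mu>_min)\<rceil> * t_mix\<close>. Each mixing time halves
  the oscillation of a function under the kernel, so that after \<open>\<tau>\<close> steps every pair \<open>i\<close> is hit with a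
  conditional probability \<open>d \<ge> \<sigma>\<close>. The increment of \<open>Q\<close> at \<open>i\<close> is therefore the drift \<open>\<alpha> d (F Q - Q)\<close>, plus a
  lag caused by comparing \<open>Q (t)\<close> with \<open>Q (t - \<tau>)\<close>, plus a noise which is centred given the history
  up to time \<open>t - \<tau>\<close>. The noise is averaged with the deterministic weights of \<open>N (t + 1) = (1 - \<alpha> \<sigma>) N (t) + \<alpha> noise\<close>,
  and an Azuma bound on each residue class modulo \<open>\<tau> + 1\<close> gives \<open>\<bar>N (t)\<bar> = O(1 / sqrt (t + t\<^sub>0))\<close>. On this event
  \<open>Q - Q\<^sup>* - N\<close> obeys a contractive recursion which preserves an envelope \<open>A / sqrt (t + t\<^sub>0) + B / (t + t\<^sub>0)\<close>.
\<close>

section \<open>Trajectories\<close>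

text \<open>The obstacle is the correlation between visits and iterates: given the whole past,
  \<open>i\<close> may have no chance at all of being visited next, so neither a lower bound on the
  drift nor a centred noise is available without looking back \<open>\<tau>\<close> steps. The
  coefficient \<open>d\<close> that results is itself random. Damping the noise average with
  \<open>d\<close> would give it weights that depend on the path, whereas the exponential moment
  bound needs a fixed linear combination; hence the constant \<open>\<sigma>\<close> in
  \<open>N\<close>. The hypotheses on the step size have separate jobs. With
  \<open>\<sigma> = \<mu>_min / 2\<close>, the bound on \<open>h\<close> says
  \<open>h \<sigma> (1 - \<gamma>) \<ge> 2\<close>: half of the contraction is spent on the noise or
  on the lag, and the other half must outrun the decay of the envelope.
  \<open>t\<^sub>0 \<ge> \<tau>\<close> keeps the step size within a factor 2 over a lag, and
  \<open>t\<^sub>0 \<ge> 4 h\<close> makes every step at most 1/4, which serves to keep the squared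
  weights of \<open>N\<close> summing to \<open>O(1 / (t + t\<^sub>0))\<close>.\<close>

definition depends_before :: "nat \<Rightarrow> ((nat \<Rightarrow> 'b) \<Rightarrow> 'c) \<Rightarrow> bool" where
  "depends_before n g \<longleftrightarrow> (\<forall>\<omega> \<omega>'. (\<forall>k<n. \<omega> k = \<omega>' k) \<longrightarrow> g \<omega> = g \<omega>')"

lemma depends_beforeD: "depends_before n g \<Longrightarrow> (\<And>k. k < n \<Longrightarrow> \<omega> k = \<omega>' k) \<Longrightarrow> g \<omega> = g \<omega>'"
  unfolding depends_before_def by blast

lemma depends_before_mono: "depends_before n g \<Longrightarrow> n \<le> m \<Longrightarrow> depends_before m g"
  unfolding depends_before_def by (meson order_less_le_trans)

lemma depends_before_const: "depends_before n (\<lambda>_. c)"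
  by (simp add: depends_before_def)

lemma depends_before_comp: "depends_before n g \<Longrightarrow> depends_before n (\<lambda>\<omega>. h (g \<omega>))"
  unfolding depends_before_def by metis

lemma depends_before_comp2:
  "depends_before n g \<Longrightarrow> depends_before n g' \<Longrightarrow> depends_before n (\<lambda>\<omega>. h (g \<omega>) (g' \<omega>))"
  unfolding depends_before_def by metis

lemma depends_before_coord: "t < n \<Longrightarrow> depends_before n (\<lambda>\<omega>. h (\<omega> t))"
  unfolding depends_before_def by metis

section \<open>The path measure and its one-step disintegration\<close>

abbreviation path_space :: "(nat \<Rightarrow> 'x \<times> real) measure" where
  "path_space \<equiv> PiM UNIV (\<lambda>_. step_space)"

lemma measurable_coord [measurable]: "(\<lambda>\<omega>. \<omega> t) \<in> path_space \<rightarrow>\<^sub>M step_space"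
  by (rule measurable_component_singleton) simp

lemma measurable_path_state [measurable]: "(\<lambda>\<omega>. fst (\<omega> t)) \<in> path_space \<rightarrow>\<^sub>M count_space UNIV"
  by (rule measurable_compose[OF measurable_component_singleton]) simp_all

lemma measurable_path_reward [measurable]: "(\<lambda>\<omega>. snd (\<omega> t)) \<in> borel_measurable path_space"
  by (rule measurable_compose[OF measurable_component_singleton]) simp_all

text \<open>Kernel and start are kept general because several laws occur: the behavioral trajectory,
  and for \<open>q_fun\<close> the trajectories of arbitrary policies started from a point
  mass.\<close>

locale reward_chain =
  fixes R :: "'x::finite \<Rightarrow> real measure" and K :: "'x \<Rightarrow> 'x pmf" and p :: "'x pmf"
  assumes reward_prob: "\<And>x. prob_space (R x)"
    and reward_sets: "\<And>x. sets (R x) = sets borel"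
begin

sublocale IT: Ionescu_Tulcea "step_law R K p" "\<lambda>_. step_space"
  by (rule Ionescu_Tulcea_step_law[OF reward_prob reward_sets])

abbreviation "M \<equiv> traj_law R K p"

lemma M_eq: "M = IT.PF.lim"
  by (simp add: traj_law_def)

lemma space_path [simp]: "space path_space = UNIV"
  by (simp add: space_PiM space_pair_measure PiE_def)

lemma space_M [simp]: "space M = UNIV"
  unfolding M_eq by (simp add: space_PiM space_pair_measure PiE_def)

lemma sets_M [measurable_cong]: "sets M = sets path_space"
  by (simp add: M_eq)

lemma measurable_of_state [measurable]:
  "(\<lambda>\<omega>. h (fst (\<omega> t))) \<in> borel_measurable path_space" for h :: "'x \<Rightarrow> 'b::topological_space"
  by (rule measurable_compose[OF measurable_path_state]) simp

text \<open>The projective limit is described by its finite marginals \<open>IT.CI\<close>. For an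
  initial segment, \<open>IT.up_to\<close> is its length, so the marginal is the finite-horizon law
  itself.\<close>

lemma distr_M: "distr M (PiM {0..<n} (\<lambda>_. step_space)) (\<lambda>\<omega>. restrict \<omega> {0..<n}) = IT.C 0 n (\<lambda>_. undefined)"
proof -
  have up: "IT.up_to {0..<n} = n"
    using IT.up_to[of "{0..<n}"] IT.up_to_iff_Ico[of "{0..<n}" n] by (cases "n = 0") auto
  have "distr M (PiM {0..<n} (\<lambda>_. step_space)) (\<lambda>\<omega>. restrict \<omega> {0..<n}) = IT.CI {0..<n}"
    unfolding M_eq by (rule IT.distr_lim) simp
  also have "\<dots> = distr (IT.C 0 n (\<lambda>_. undefined)) (PiM {0..<n} (\<lambda>_. step_space)) (\<lambda>\<omega>. restrict \<omega> {0..<n})"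
    by (simp add: IT.CI_def up)
  also have "\<dots> = IT.C 0 n (\<lambda>_. undefined)"
    using IT.distr_C[of n n "\<lambda>_. undefined" 0] by (simp add: space_PiM)
  finally show ?thesis .
qed

lemma prob_space_M: "prob_space M"
proof -
  have "prob_space (distr M (PiM {0..<0} (\<lambda>_. step_space)) (\<lambda>\<omega>. restrict \<omega> {0..<0}))"
    unfolding distr_M by (rule IT.prob_space_C) (simp add: space_PiM)
  then show ?thesis
    by (rule prob_space_distrD[rotated]) (auto intro!: measurable_restrict)
qed

sublocale M: prob_space M
  by (rule prob_space_M)

lemma integrable_bounded:
  fixes u :: "(nat \<Rightarrow> 'x \<times> real) \<Rightarrow> real"
  assumes "u \<in> borel_measurable path_space" and "\<And>\<omega>. \<bar>u \<omega>\<bar> \<le> c"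
  shows "integrable M u"
  using assms by (intro M.integrable_const_bound[of _ c]) (auto simp: measurable_cong_sets[OF sets_M refl])

text \<open>A point of the finite product is \<open>undefined\<close> from \<open>n\<close> on, so
  it is already a path, constant in those coordinates, and no extension map is needed.\<close>

lemma path_of_prefix: "(\<lambda>\<omega>. \<omega>) \<in> PiM {0..<n} (\<lambda>_. step_space :: ('x \<times> real) measure) \<rightarrow>\<^sub>M path_space"
proof (rule measurable_PiM_single')
  fix k :: nat
  show "(\<lambda>\<omega>. \<omega> k) \<in> PiM {0..<n} (\<lambda>_. step_space :: ('x \<times> real) measure) \<rightarrow>\<^sub>M step_space"
  proof (cases "k < n")
    case False
    then show ?thesis
      by (subst measurable_cong[where g = "\<lambda>_. undefined"]) (auto simp: space_PiM PiE_def extensional_def space_pair_measure)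
  qed (auto intro: measurable_component_singleton)
qed (auto simp: space_pair_measure)

text \<open>Filtrations are avoided: measurability on \<open>path_space\<close> together with
  \<open>depends_before n\<close> plays the part of measurability with respect to the first
  \<open>n\<close> steps, and lets the integral be taken over the finite-horizon law.\<close>

lemma nn_integral_M:
  assumes g [measurable]: "g \<in> borel_measurable path_space" and dep: "depends_before n g"
  shows "(\<integral>\<^sup>+\<omega>. g \<omega> \<partial>M) = (\<integral>\<^sup>+\<omega>. g \<omega> \<partial>IT.C 0 n (\<lambda>_. undefined))"
proof -
  have [measurable]: "g \<in> borel_measurable (PiM {0..<n} (\<lambda>_. step_space))"
    using measurable_compose[OF path_of_prefix g] .
  have "(\<integral>\<^sup>+\<omega>. g \<omega> \<partial>IT.C 0 n (\<lambda>_. undefined)) = (\<integral>\<^sup>+\<omega>. g (restrict \<omega> {0..<n}) \<partial>M)"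
    unfolding distr_M[symmetric] by (subst nn_integral_distr) (auto intro!: measurable_restrict)
  also have "\<dots> = (\<integral>\<^sup>+\<omega>. g \<omega> \<partial>M)"
    by (intro nn_integral_cong depends_beforeD[OF dep]) auto
  finally show ?thesis ..
qed

lemma step_law_Suc [simp]: "step_law R K p (Suc t) \<omega> = with_reward R (K (fst (\<omega> t)))"
  by (simp add: step_law_def)

lemma step_law_0 [simp]: "step_law R K p 0 \<omega> = with_reward R p"
  by (simp add: step_law_def)

lemma prob_space_with_reward: "prob_space (with_reward R q)"
  and sets_with_reward [measurable_cong, simp]: "sets (with_reward R q) = sets step_space"
  using with_reward_in_prob_algebra[of R, OF reward_prob reward_sets, of q]
  by (auto simp: space_prob_algebra)

lemma measurable_integral_step_law [measurable]:
  "(\<lambda>\<omega>. \<integral>y. f y \<partial>step_law R K p t \<omega>) \<in> borel_measurable path_space" for f :: "'x \<times> real \<Rightarrow> real"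
proof (cases t)
  case (Suc n)
  then show ?thesis
    using measurable_of_state[of "\<lambda>x. \<integral>y. f y \<partial>with_reward R (K x)" n] by simp
qed simp

lemma measurable_nn_integral_step_law [measurable]:
  "(\<lambda>\<omega>. \<integral>\<^sup>+y. f y \<partial>step_law R K p t \<omega>) \<in> borel_measurable path_space"
proof (cases t)
  case (Suc n)
  then show ?thesis
    using measurable_of_state[of "\<lambda>x. \<integral>\<^sup>+y. f y \<partial>with_reward R (K x)" n] by simp
qed simp

text \<open>Tower property: the law of the first \<open>t + 1\<close> steps is the law of the first
  \<open>t\<close> followed by the kernel \<open>IT.eP t\<close>, and \<open>g\<close> does not see
  the coordinate that the kernel adds.\<close>

lemma nn_integral_step:
  assumes g [measurable]: "g \<in> borel_measurable path_space" and dep: "depends_before t g"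
    and f [measurable]: "f \<in> borel_measurable step_space"
  shows "(\<integral>\<^sup>+\<omega>. g \<omega> * f (\<omega> t) \<partial>M) = (\<integral>\<^sup>+\<omega>. g \<omega> * (\<integral>\<^sup>+y. f y \<partial>step_law R K p t \<omega>) \<partial>M)"
proof -
  let ?C = "\<lambda>n. IT.C 0 n (\<lambda>_. undefined)"
  let ?P = "\<lambda>n. PiM {0..<n} (\<lambda>_. step_space :: ('x \<times> real) measure)"
  have gP: "g \<in> borel_measurable (?P n)" for n
    using measurable_compose[OF path_of_prefix g] .
  have fP: "(\<lambda>\<omega>. f (\<omega> t)) \<in> borel_measurable (?P (Suc t))"
    by (rule measurable_compose[OF _ f]) (rule measurable_component_singleton, simp)
  have "(\<integral>\<^sup>+\<omega>. g \<omega> * f (\<omega> t) \<partial>M) = (\<integral>\<^sup>+\<omega>. g \<omega> * f (\<omega> t) \<partial>?C (Suc t))"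
  proof (rule nn_integral_M)
    show "depends_before (Suc t) (\<lambda>\<omega>. g \<omega> * f (\<omega> t))"
      by (rule depends_before_comp2[OF depends_before_mono[OF dep] depends_before_coord[where h = f]]) simp_all
  qed measurable
  also have "\<dots> = (\<integral>\<^sup>+\<omega>. (\<integral>\<^sup>+\<omega>'. g \<omega>' * f (\<omega>' t) \<partial>IT.eP (0 + t) \<omega>) \<partial>?C t)"
    unfolding IT.C.simps
  proof (rule nn_integral_bind[where B = "?P (Suc t)"])
    show "(\<lambda>\<omega>. g \<omega> * f (\<omega> t)) \<in> borel_measurable (?P (Suc t))"
      using gP fP by (rule borel_measurable_times_ennreal)
    have "sets (?C t) = sets (?P t)"
      using IT.sets_C[of "\<lambda>_. undefined" 0 t] by (simp add: space_PiM)
    then show "IT.eP (0 + t) \<in> ?C t \<rightarrow>\<^sub>M subprob_algebra (?P (Suc t))"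
      using IT.measurable_eP[of t] by (simp cong: measurable_cong_sets)
  qed
  also have "\<dots> = (\<integral>\<^sup>+\<omega>. g \<omega> * (\<integral>\<^sup>+y. f y \<partial>step_law R K p t \<omega>) \<partial>?C t)"
    unfolding add_0
  proof (rule nn_integral_cong)
    fix \<omega> assume "\<omega> \<in> space (?C t)"
    then have \<omega>: "\<omega> \<in> space (?P t)"
      by (subst (asm) IT.space_C) (auto simp: space_PiM)
    have "(\<integral>\<^sup>+\<omega>'. g \<omega>' * f (\<omega>' t) \<partial>IT.eP t \<omega>) = (\<integral>\<^sup>+y. g (fun_upd \<omega> t y) * f y \<partial>step_law R K p t \<omega>)"
      by (subst IT.nn_integral_eP[OF \<omega>]) (use gP fP in auto)
    also have "\<dots> = (\<integral>\<^sup>+y. g \<omega> * f y \<partial>step_law R K p t \<omega>)"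
      using depends_beforeD[OF dep] by (intro nn_integral_cong) (metis fun_upd_other nat_neq_iff)
    also have "\<dots> = g \<omega> * (\<integral>\<^sup>+y. f y \<partial>step_law R K p t \<omega>)"
      by (intro nn_integral_cmult) (simp add: step_law_def measurable_cong_sets[OF sets_with_reward refl])
    finally show "(\<integral>\<^sup>+\<omega>'. g \<omega>' * f (\<omega>' t) \<partial>IT.eP t \<omega>) = g \<omega> * (\<integral>\<^sup>+y. f y \<partial>step_law R K p t \<omega>)" .
  qed
  also have "\<dots> = (\<integral>\<^sup>+\<omega>. g \<omega> * (\<integral>\<^sup>+y. f y \<partial>step_law R K p t \<omega>) \<partial>M)"
  proof (rule nn_integral_M[symmetric])
    show "(\<lambda>\<omega>. g \<omega> * (\<integral>\<^sup>+y. f y \<partial>step_law R K p t \<omega>)) \<in> borel_measurable path_space"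
      by measurable
    show "depends_before t (\<lambda>\<omega>. g \<omega> * (\<integral>\<^sup>+y. f y \<partial>step_law R K p t \<omega>))"
    proof (cases t)
      case 0
      show ?thesis
        unfolding 0 step_law_0 by (rule depends_before_comp[OF dep[unfolded 0]])
    next
      case (Suc n)
      show ?thesis
        unfolding Suc step_law_Suc
        by (rule depends_before_comp2[OF dep[unfolded Suc]
              depends_before_coord[where h = "\<lambda>z. \<integral>\<^sup>+y. f y \<partial>with_reward R (K (fst z))"]]) simp
    qed
  qed
  finally show ?thesis .
qed

lemma integral_step_nonneg:
  assumes g [measurable]: "g \<in> borel_measurable path_space" and dep: "depends_before t g"
    and f [measurable]: "f \<in> borel_measurable step_space"
    and bg: "\<And>\<omega>. 0 \<le> g \<omega> \<and> g \<omega> \<le> B" and bf: "\<And>y. 0 \<le> f y \<and> f y \<le> (C::real)"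
  shows "(\<integral>\<omega>. g \<omega> * f (\<omega> t) \<partial>M) = (\<integral>\<omega>. g \<omega> * (\<integral>y. f y \<partial>step_law R K p t \<omega>) \<partial>M)"
proof -
  have inner: "(\<integral>\<^sup>+y. ennreal (f y) \<partial>step_law R K p t \<omega>) = ennreal (\<integral>y. f y \<partial>step_law R K p t \<omega>)" for \<omega>
  proof (rule nn_integral_eq_integral)
    interpret prob_space "step_law R K p t \<omega>"
      unfolding step_law_def by (rule prob_space_with_reward)
    show "integrable (step_law R K p t \<omega>) f"
      by (rule integrable_const_bound[of _ C])
        (use bf in \<open>auto simp: step_law_def measurable_cong_sets[OF sets_with_reward refl]\<close>)
  qed (use bf in auto)
  have pos: "0 \<le> (\<integral>y. f y \<partial>step_law R K p t \<omega>)" for \<omega>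
    using bf by (intro integral_nonneg_AE) auto
  have "(\<integral>\<omega>. g \<omega> * f (\<omega> t) \<partial>M) = enn2real (\<integral>\<^sup>+\<omega>. ennreal (g \<omega>) * ennreal (f (\<omega> t)) \<partial>M)"
    using bg bf by (subst integral_eq_nn_integral) (auto simp: ennreal_mult)
  also have "(\<integral>\<^sup>+\<omega>. ennreal (g \<omega>) * ennreal (f (\<omega> t)) \<partial>M)
      = (\<integral>\<^sup>+\<omega>. ennreal (g \<omega>) * (\<integral>\<^sup>+y. ennreal (f y) \<partial>step_law R K p t \<omega>) \<partial>M)"
    by (rule nn_integral_step[where g = "\<lambda>\<omega>. ennreal (g \<omega>)" and f = "\<lambda>y. ennreal (f y)"])
       (auto intro: depends_before_comp[OF dep])
  also have "enn2real \<dots> = (\<integral>\<omega>. g \<omega> * (\<integral>y. f y \<partial>step_law R K p t \<omega>) \<partial>M)"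
    using bg pos by (subst integral_eq_nn_integral) (auto simp: ennreal_mult inner)
  finally show ?thesis .
qed

text \<open>Reduction to the nonnegative case: the identity for \<open>(g + B) (f + C)\<close> minus
  the one for \<open>B (f + C)\<close> leaves the identity for \<open>g (f + C)\<close>, and the
  terms \<open>g C\<close> agree on both sides.\<close>

lemma integral_step:
  assumes g [measurable]: "g \<in> borel_measurable path_space" and dep: "depends_before t g"
    and f [measurable]: "f \<in> borel_measurable step_space"
    and bg: "\<And>\<omega>. \<bar>g \<omega>\<bar> \<le> B" and bf: "\<And>y. \<bar>f y\<bar> \<le> (C::real)"
  shows "(\<integral>\<omega>. g \<omega> * f (\<omega> t) \<partial>M) = (\<integral>\<omega>. g \<omega> * (\<integral>y. f y \<partial>step_law R K p t \<omega>) \<partial>M)"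
proof -
  let ?S = "step_law R K p t"
  have sp: "prob_space (?S \<omega>)" and ss: "sets (?S \<omega>) = sets step_space" for \<omega>
    unfolding step_law_def by (auto intro: prob_space_with_reward)
  have If: "integrable (?S \<omega>) f" for \<omega>
  proof -
    interpret prob_space "?S \<omega>" by (rule sp)
    show ?thesis
      by (rule integrable_const_bound[of _ C]) (use bf in \<open>auto simp: ss measurable_cong_sets[OF ss refl]\<close>)
  qed
  have inner: "(\<integral>y. f y + C \<partial>?S \<omega>) = (\<integral>y. f y \<partial>?S \<omega>) + C" for \<omega>
  proof -
    interpret prob_space "?S \<omega>" by (rule sp)
    show ?thesis using If[of \<omega>] by (simp add: prob_space)
  qed
  have bI: "\<bar>\<integral>y. f y \<partial>?S \<omega>\<bar> \<le> C" for \<omega>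
  proof -
    interpret prob_space "?S \<omega>" by (rule sp)
    have "\<bar>\<integral>y. f y \<partial>?S \<omega>\<bar> \<le> (\<integral>y. \<bar>f y\<bar> \<partial>?S \<omega>)" by (rule integral_abs_bound)
    also have "\<dots> \<le> (\<integral>y. C \<partial>?S \<omega>)"
      using If bf by (intro integral_mono integrable_abs) auto
    finally show ?thesis by (simp add: prob_space)
  qed
  have B0: "0 \<le> B" and C0: "0 \<le> C" using bg[of undefined] bf[of undefined] by auto
  have bg': "0 \<le> g \<omega> + B \<and> g \<omega> + B \<le> 2 * B" for \<omega> using bg[of \<omega>] by (auto simp: abs_le_iff)
  have bf': "0 \<le> f y + C \<and> f y + C \<le> 2 * C" for y using bf[of y] by (auto simp: abs_le_iff)
  have dep': "depends_before t (\<lambda>\<omega>. g \<omega> + B)" "depends_before t (\<lambda>\<omega>. B)"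
    by (rule depends_before_comp[OF dep], rule depends_before_const)
  have i1: "integrable M (\<lambda>\<omega>. g \<omega> * f (\<omega> t))"
    by (rule integrable_bounded[where c = "B * C"]) (simp_all add: abs_mult mult_mono bg bf B0)
  have i2: "integrable M (\<lambda>\<omega>. f (\<omega> t))"
    by (rule integrable_bounded[where c = C]) (simp_all add: bf)
  have i3: "integrable M g"
    by (rule integrable_bounded[where c = B]) (simp_all add: bg)
  have i4: "integrable M (\<lambda>\<omega>. g \<omega> * (\<integral>y. f y \<partial>?S \<omega>))"
    by (rule integrable_bounded[where c = "B * C"]) (simp_all add: abs_mult mult_mono bg bI B0)
  have i5: "integrable M (\<lambda>\<omega>. (\<integral>y. f y \<partial>?S \<omega>))"
    by (rule integrable_bounded[where c = C]) (simp_all add: bI)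
  have "(\<integral>\<omega>. (g \<omega> + B) * (f (\<omega> t) + C) \<partial>M) = (\<integral>\<omega>. (g \<omega> + B) * (\<integral>y. f y + C \<partial>?S \<omega>) \<partial>M)"
    by (rule integral_step_nonneg[OF _ dep'(1) _ bg' bf']) auto
  moreover have "(\<integral>\<omega>. B * (f (\<omega> t) + C) \<partial>M) = (\<integral>\<omega>. B * (\<integral>y. f y + C \<partial>?S \<omega>) \<partial>M)"
    by (rule integral_step_nonneg[OF _ dep'(2) _ _ bf', where B = B]) (auto simp: B0)
  ultimately show ?thesis
    using i1 i2 i3 i4 i5 unfolding inner by (auto simp: ring_distribs M.prob_space)
qed

lemma with_reward_kernel: "(\<lambda>x. distr (R x) step_space (Pair x)) \<in> count_space UNIV \<rightarrow>\<^sub>M prob_algebra step_space"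
proof -
  have R: "R x \<in> space (prob_algebra borel)" for x
    using reward_prob reward_sets by (simp add: space_prob_algebra)
  have "distr (R x) step_space (Pair x) \<in> space (prob_algebra step_space)" for x
    using R[of x] by (intro measurable_space[OF measurable_distr_prob_space]) simp_all
  then show ?thesis by simp
qed

lemma nn_integral_with_reward:
  assumes [measurable]: "f \<in> borel_measurable step_space"
  shows "(\<integral>\<^sup>+y. f y \<partial>with_reward R q) = (\<integral>\<^sup>+x. \<integral>\<^sup>+r. f (x, r) \<partial>R x \<partial>measure_pmf q)"
proof -
  have "(\<integral>\<^sup>+y. f y \<partial>with_reward R q) = (\<integral>\<^sup>+x. \<integral>\<^sup>+y. f y \<partial>distr (R x) step_space (Pair x) \<partial>measure_pmf q)"
    unfolding with_reward_def
  proof (rule nn_integral_bind)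
    show "(\<lambda>x. distr (R x) step_space (Pair x)) \<in> measure_pmf q \<rightarrow>\<^sub>M subprob_algebra step_space"
      using measurable_prob_algebraD[OF with_reward_kernel]
      by (simp only: measurable_cong_sets[OF sets_measure_pmf_count_space refl])
  qed fact
  also have "\<dots> = (\<integral>\<^sup>+x. \<integral>\<^sup>+r. f (x, r) \<partial>R x \<partial>measure_pmf q)"
    by (intro nn_integral_cong nn_integral_distr) (auto simp: measurable_cong_sets[OF reward_sets refl])
  finally show ?thesis .
qed

end


section \<open>Expectations over finite types\<close>

abbreviation pmf_mean :: "'x pmf \<Rightarrow> ('x \<Rightarrow> real) \<Rightarrow> real" where
  "pmf_mean q u \<equiv> measure_pmf.expectation q u"

lemma pmf_mean_sum: "pmf_mean q u = (\<Sum>x\<in>UNIV. pmf q x * u x)" for u :: "'x::finite \<Rightarrow> real"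
  by (subst integral_measure_pmf[of UNIV]) auto

lemma pmf_mean_bind: "pmf_mean (bind_pmf q f) u = pmf_mean q (\<lambda>x. pmf_mean (f x) u)" for q :: "'x::finite pmf" and u :: "'y::finite \<Rightarrow> real"
  by (subst pmf_expectation_bind[of UNIV]) (auto simp: pmf_mean_sum[of q])

lemma pmf_mean_mono: "(\<And>x. u x \<le> v x) \<Longrightarrow> pmf_mean q u \<le> pmf_mean q v" for u :: "'x::finite \<Rightarrow> real"
  by (intro integral_mono integrable_measure_pmf_finite) auto

lemma pmf_mean_abs_le: "(\<And>x. \<bar>u x\<bar> \<le> c) \<Longrightarrow> \<bar>pmf_mean q u\<bar> \<le> c" for u :: "'x::finite \<Rightarrow> real"
  using pmf_mean_mono[of u "\<lambda>_. c" q] pmf_mean_mono[of "\<lambda>_. - c" u q]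
  by (simp add: abs_le_iff minus_le_iff)

lemma pmf_mean_diff: "pmf_mean q (\<lambda>x. u x - v x) = pmf_mean q u - pmf_mean q v" for u v :: "'x::finite \<Rightarrow> real"
  by (intro Bochner_Integration.integral_diff integrable_measure_pmf_finite) auto

text \<open>\<open>nstep\<close> appends transitions at the end; the Bellman equation needs the
  first one split off.\<close>

lemma nstep_Suc_left: "nstep K (Suc n) x = bind_pmf (K x) (nstep K n)"
proof (induction n)
  case 0
  have "nstep K 0 = return_pmf" by (rule ext) simp
  then show ?case by (simp add: bind_return_pmf bind_return_pmf')
next
  case (Suc n)
  have "nstep K (Suc (Suc n)) x = bind_pmf (bind_pmf (K x) (nstep K n)) K"
    using Suc by simp
  then show ?case by (simp add: bind_assoc_pmf)
qed

definition clip :: "real \<Rightarrow> real \<Rightarrow> real" where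
  "clip b r = max (- b) (min b r)"

lemma clip_bound: "0 \<le> b \<Longrightarrow> \<bar>clip b r\<bar> \<le> b"
  by (auto simp: clip_def)

lemma clip_id: "\<bar>r\<bar> \<le> b \<Longrightarrow> clip b r = r"
  by (auto simp: clip_def)

lemma clip_measurable [measurable]: "clip b \<in> borel_measurable borel"
  unfolding clip_def[abs_def] by measurable

definition reward_mean :: "('x \<Rightarrow> real measure) \<Rightarrow> 'x \<Rightarrow> real" where
  "reward_mean R x = (\<integral>r. r \<partial>R x)"

section \<open>Markov property, marginals and almost sure reward bounds\<close>

context reward_chain
begin

lemma measurable_R [measurable_cong]: "sets (R x) = sets borel"
  by (rule reward_sets)

lemma prob_M_UNIV [simp]: "M.prob UNIV = 1"
  using M.prob_space by simp

lemma measurable_at: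
  assumes "f \<in> borel_measurable step_space"
  shows "(\<lambda>r. f (x, r)) \<in> borel_measurable borel"
  by (rule measurable_compose[OF _ assms]) simp

lemma integral_with_reward_nonneg:
  fixes f :: "'x \<times> real \<Rightarrow> real"
  assumes f: "f \<in> borel_measurable step_space" and bf: "\<And>y. 0 \<le> f y \<and> f y \<le> C"
  shows "(\<integral>y. f y \<partial>with_reward R q) = pmf_mean q (\<lambda>x. \<integral>r. f (x, r) \<partial>R x)"
proof -
  have inner: "(\<integral>\<^sup>+r. ennreal (f (x, r)) \<partial>R x) = ennreal (\<integral>r. f (x, r) \<partial>R x)" for x
  proof (rule nn_integral_eq_integral)
    interpret prob_space "R x" by (rule reward_prob)
    show "integrable (R x) (\<lambda>r. f (x, r))"
      by (rule integrable_const_bound[of _ C])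
        (use bf measurable_at[OF f] in \<open>auto simp: measurable_cong_sets[OF reward_sets refl]\<close>)
  qed (use bf in auto)
  have pos: "0 \<le> (\<integral>r. f (x, r) \<partial>R x)" for x
    using bf by (intro integral_nonneg_AE) auto
  have "(\<integral>y. f y \<partial>with_reward R q) = enn2real (\<integral>\<^sup>+y. ennreal (f y) \<partial>with_reward R q)"
    using f bf by (intro integral_eq_nn_integral) (auto simp: measurable_cong_sets[OF sets_with_reward refl])
  also have "(\<integral>\<^sup>+y. ennreal (f y) \<partial>with_reward R q) = (\<integral>\<^sup>+x. ennreal (\<integral>r. f (x, r) \<partial>R x) \<partial>measure_pmf q)"
    using f by (subst nn_integral_with_reward) (auto simp: inner)
  also have "\<dots> = ennreal (pmf_mean q (\<lambda>x. \<integral>r. f (x, r) \<partial>R x))"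
    using pos by (intro nn_integral_eq_integral integrable_measure_pmf_finite) auto
  finally show ?thesis
    using pos by (simp add: integral_nonneg_AE)
qed

lemma integral_with_reward:
  fixes f :: "'x \<times> real \<Rightarrow> real"
  assumes f [measurable]: "f \<in> borel_measurable step_space" and bf: "\<And>y. \<bar>f y\<bar> \<le> C"
  shows "(\<integral>y. f y \<partial>with_reward R q) = pmf_mean q (\<lambda>x. \<integral>r. f (x, r) \<partial>R x)"
proof -
  have bf': "0 \<le> f y + C \<and> f y + C \<le> 2 * C" for y
    using bf[of y] by (auto simp: abs_le_iff)
  have 1: "(\<integral>y. f y + C \<partial>with_reward R q) = (\<integral>y. f y \<partial>with_reward R q) + C"
  proof -
    interpret prob_space "with_reward R q" by (rule prob_space_with_reward)
    have "integrable (with_reward R q) f"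
      by (rule integrable_const_bound[of _ C])
        (use f bf in \<open>auto simp: measurable_cong_sets[OF sets_with_reward refl]\<close>)
    then show ?thesis by (simp add: prob_space)
  qed
  have 2: "(\<integral>r. f (x, r) + C \<partial>R x) = (\<integral>r. f (x, r) \<partial>R x) + C" for x
  proof -
    interpret prob_space "R x" by (rule reward_prob)
    have "integrable (R x) (\<lambda>r. f (x, r))"
      by (rule integrable_const_bound[of _ C])
        (use bf measurable_at[OF f] in \<open>auto simp: measurable_cong_sets[OF reward_sets refl]\<close>)
    then show ?thesis by (simp add: prob_space)
  qed
  have "(\<integral>y. f y + C \<partial>with_reward R q) = pmf_mean q (\<lambda>x. \<integral>r. f (x, r) + C \<partial>R x)"
    by (rule integral_with_reward_nonneg[OF _ bf']) simp
  then show ?thesis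
    unfolding 1 2 by (simp add: integrable_measure_pmf_finite)
qed

lemma integral_step_Suc:
  assumes "g \<in> borel_measurable path_space" "depends_before (Suc t) g" "f \<in> borel_measurable step_space"
    and bg: "\<And>\<omega>. \<bar>g \<omega>\<bar> \<le> B" and bf: "\<And>y. \<bar>f y\<bar> \<le> C"
  shows "(\<integral>\<omega>. g \<omega> * f (\<omega> (Suc t)) \<partial>M)
    = (\<integral>\<omega>. g \<omega> * pmf_mean (K (fst (\<omega> t))) (\<lambda>x. \<integral>r. f (x, r) \<partial>R x) \<partial>M)"
  using integral_step[OF assms] integral_with_reward[OF assms(3) bf] by simp

lemma integral_step_state:
  fixes u :: "'x \<Rightarrow> real"
  assumes g: "g \<in> borel_measurable path_space" "depends_before (Suc t) g"
    and bg: "\<And>\<omega>. \<bar>g \<omega>\<bar> \<le> B"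
  shows "(\<integral>\<omega>. g \<omega> * u (fst (\<omega> (Suc t))) \<partial>M) = (\<integral>\<omega>. g \<omega> * pmf_mean (K (fst (\<omega> t))) u \<partial>M)"
proof -
  have R1: "measure (R x) (space (R x)) = 1" for x
    by (rule prob_space.prob_space[OF reward_prob])
  have "(\<lambda>y. u (fst y)) \<in> borel_measurable step_space"
    by (rule measurable_compose[OF measurable_fst]) simp
  then show ?thesis
    using integral_step_Suc[OF g _ bg, where f = "\<lambda>y. u (fst y)" and C = "Max (range (\<lambda>x. \<bar>u x\<bar>))"]
    by (simp add: R1)
qed

text \<open>The Markov property over \<open>n\<close> steps. The last transition is absorbed into
  \<open>u\<close> until only the state at time \<open>t\<close> remains. With
  \<open>n = \<tau>\<close> this centres the visits given the delayed history.\<close>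

lemma integral_nstep_state:
  fixes u :: "'x \<Rightarrow> real"
  assumes g: "g \<in> borel_measurable path_space" "depends_before (Suc t) g"
    and bg: "\<And>\<omega>. \<bar>g \<omega>\<bar> \<le> B"
  shows "(\<integral>\<omega>. g \<omega> * u (fst (\<omega> (t + n))) \<partial>M) = (\<integral>\<omega>. g \<omega> * pmf_mean (nstep K n (fst (\<omega> t))) u \<partial>M)"
proof (induction n arbitrary: u)
  case (Suc n)
  have "(\<integral>\<omega>. g \<omega> * u (fst (\<omega> (t + Suc n))) \<partial>M) = (\<integral>\<omega>. g \<omega> * pmf_mean (K (fst (\<omega> (t + n)))) u \<partial>M)"
    using integral_step_state[OF g(1) depends_before_mono[OF g(2)] bg, of "t + n" u] by simp
  then show ?case
    using Suc[of "\<lambda>x. pmf_mean (K x) u"] by (simp add: pmf_mean_bind)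
qed simp

definition state_law :: "nat \<Rightarrow> 'x pmf" where
  "state_law t = bind_pmf p (nstep K t)"

lemma integral_coord:
  fixes f :: "'x \<times> real \<Rightarrow> real"
  assumes f: "f \<in> borel_measurable step_space" and bf: "\<And>y. \<bar>f y\<bar> \<le> C"
  shows "(\<integral>\<omega>. f (\<omega> t) \<partial>M) = pmf_mean (state_law t) (\<lambda>x. \<integral>r. f (x, r) \<partial>R x)"
proof -
  have start: "(\<integral>\<omega>. f (\<omega> 0) \<partial>M) = pmf_mean p (\<lambda>x. \<integral>r. f (x, r) \<partial>R x)"
    if f: "f \<in> borel_measurable step_space" and bf: "\<And>y. \<bar>f y\<bar> \<le> C" for f :: "'x \<times> real \<Rightarrow> real" and C
    using integral_step[where g = "\<lambda>_. 1" and t = 0 and f = f and B = 1 and C = C, OF _ depends_before_const f] integral_with_reward[OF f bf] bf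
    by (simp add: M.prob_space)
  show ?thesis
  proof (cases t)
    case 0
    have "nstep K 0 = return_pmf" by (rule ext) simp
    then show ?thesis using start[OF f bf] 0 by (simp add: state_law_def bind_return_pmf')
  next
    case (Suc n)
    have R1: "measure (R x) (space (R x)) = 1" for x
      by (rule prob_space.prob_space[OF reward_prob])
    let ?u = "\<lambda>x. \<integral>r. f (x, r) \<partial>R x"
    let ?v = "\<lambda>x. pmf_mean (nstep K (Suc n) x) ?u"
    have mu: "(\<lambda>y. v (fst y)) \<in> borel_measurable step_space" for v :: "'x \<Rightarrow> real"
      by (rule measurable_compose[OF measurable_fst]) simp
    have "(\<integral>\<omega>. f (\<omega> (Suc n)) \<partial>M) = (\<integral>\<omega>. 1 * pmf_mean (K (fst (\<omega> n))) ?u \<partial>M)"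
      using integral_step_Suc[where g = "\<lambda>_. 1" and t = n and f = f and B = 1 and C = C, OF _ depends_before_const f] bf by simp
    also have "\<dots> = (\<integral>\<omega>. 1 * pmf_mean (nstep K n (fst (\<omega> 0))) (\<lambda>x. pmf_mean (K x) ?u) \<partial>M)"
      using integral_nstep_state[where g = "\<lambda>_. 1" and t = 0 and n = n and u = "\<lambda>x. pmf_mean (K x) ?u" and B = 1, OF _ depends_before_const] by simp
    also have "\<dots> = (\<integral>\<omega>. pmf_mean (nstep K (Suc n) (fst (\<omega> 0))) ?u \<partial>M)"
      by (simp add: pmf_mean_bind)
    also have "\<dots> = pmf_mean p (\<lambda>x. pmf_mean (nstep K (Suc n) x) ?u)"
      using start[OF mu[of ?v], of "Max (range (\<lambda>x. \<bar>?v x\<bar>))"]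
      by (simp add: R1 del: nstep.simps)
    also have "\<dots> = pmf_mean (state_law t) ?u"
      by (simp add: state_law_def pmf_mean_bind Suc del: nstep.simps)
    finally show ?thesis by (simp add: Suc)
  qed
qed

text \<open>Carries null sets between the trajectory and the reward distributions, in one direction
  for each of the next two lemmas.\<close>

lemma prob_coord:
  assumes A: "A \<in> sets borel"
  shows "M.prob {\<omega>. fst (\<omega> t) = x \<and> snd (\<omega> t) \<in> A} = pmf (state_law t) x * measure (R x) A"
proof -
  let ?f = "\<lambda>y. indicator {x} (fst y) * indicator A (snd y) :: real"
  have f: "?f \<in> borel_measurable step_space"
    using A by measurable
  have "{\<omega>. fst (\<omega> t) = x \<and> snd (\<omega> t) \<in> A} \<in> sets path_space"
  proof -
    have "{\<omega> \<in> space path_space. fst (\<omega> t) = x \<and> snd (\<omega> t) \<in> A} \<in> sets (path_space :: (nat \<Rightarrow> 'x \<times> real) measure)"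
      using A by measurable
    then show ?thesis by simp
  qed
  then have "M.prob {\<omega>. fst (\<omega> t) = x \<and> snd (\<omega> t) \<in> A} = (\<integral>\<omega>. ?f (\<omega> t) \<partial>M)"
    by (subst Bochner_Integration.integral_cong[where g = "indicator {\<omega>. fst (\<omega> t) = x \<and> snd (\<omega> t) \<in> A}" and N = M])
       (auto simp: indicator_def sets_M)
  also have "\<dots> = pmf_mean (state_law t) (\<lambda>x. \<integral>r. ?f (x, r) \<partial>R x)"
    by (rule integral_coord[OF f, where C = 1]) (auto simp: indicator_def)
  also have "\<dots> = (\<Sum>y\<in>UNIV. pmf (state_law t) y * (indicator {x} y * measure (R y) A))"
    using A by (simp add: pmf_mean_sum reward_sets)
  also have "\<dots> = (\<Sum>y\<in>UNIV. if y = x then pmf (state_law t) x * measure (R x) A else 0)"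
    by (intro sum.cong) auto
  finally show ?thesis by simp
qed

lemma AE_rewards_bounded:
  assumes "\<And>x. AE r in R x. \<bar>r\<bar> \<le> b"
  shows "AE \<omega> in M. \<forall>t. \<bar>snd (\<omega> t)\<bar> \<le> b"
proof -
  have "AE \<omega> in M. \<forall>x. \<not> (fst (\<omega> t) = x \<and> snd (\<omega> t) \<in> {r. b < \<bar>r\<bar>})" for t
  unfolding AE_all_countable
  proof
    fix x
    have A: "{r. b < \<bar>r\<bar>} \<in> sets borel" by measurable
    have "measure (R x) {r. b < \<bar>r\<bar>} = 0"
      using assms[of x] prob_space.prob_eq_0[OF reward_prob, of "{r. b < \<bar>r\<bar>}" x] A by (simp add: reward_sets not_less)
    then have "M.prob {\<omega>. fst (\<omega> t) = x \<and> snd (\<omega> t) \<in> {r. b < \<bar>r\<bar>}} = 0"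
      by (simp only: prob_coord[OF A])
    moreover have "{\<omega> \<in> space path_space. fst (\<omega> t) = x \<and> snd (\<omega> t) \<in> {r. b < \<bar>r\<bar>}} \<in> sets (path_space :: (nat \<Rightarrow> 'x \<times> real) measure)"
      using A by measurable
    ultimately show "AE \<omega> in M. \<not> (fst (\<omega> t) = x \<and> snd (\<omega> t) \<in> {r. b < \<bar>r\<bar>})"
      by (simp add: M.prob_eq_0 sets_M)
  qed
  then show ?thesis
    by (auto simp: AE_all_countable not_less)
qed

lemma reward_bounded_of_AE:
  assumes AE: "AE \<omega> in M. \<forall>t. \<bar>snd (\<omega> t)\<bar> \<le> b" and pos: "pmf (state_law t) x > 0"
  shows "AE r in R x. \<bar>r\<bar> \<le> b"
proof -
  have A: "{r. b < \<bar>r\<bar>} \<in> sets borel" by measurable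
  have "{\<omega> \<in> space path_space. fst (\<omega> t) = x \<and> snd (\<omega> t) \<in> {r. b < \<bar>r\<bar>}} \<in> sets (path_space :: (nat \<Rightarrow> 'x \<times> real) measure)"
    using A by measurable
  moreover have "AE \<omega> in M. \<not> (fst (\<omega> t) = x \<and> snd (\<omega> t) \<in> {r. b < \<bar>r\<bar>})"
    using AE by eventually_elim (auto simp: not_less)
  ultimately have "M.prob {\<omega>. fst (\<omega> t) = x \<and> snd (\<omega> t) \<in> {r. b < \<bar>r\<bar>}} = 0"
    by (simp add: M.prob_eq_0 sets_M)
  with pos have "measure (R x) {r. b < \<bar>r\<bar>} = 0"
    by (simp only: prob_coord[OF A]) auto
  then show ?thesis
    using prob_space.prob_eq_0[OF reward_prob, of "{r. b < \<bar>r\<bar>}" x] A by (simp add: reward_sets not_less)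
qed

end


section \<open>Expected discounted rewards\<close>

context reward_chain
begin

lemma integral_clip_reward:
  assumes "AE r in R x. \<bar>r\<bar> \<le> b"
  shows "(\<integral>r. clip b r \<partial>R x) = reward_mean R x"
  unfolding reward_mean_def
proof (rule integral_cong_AE)
  show "AE r in R x. clip b r = r"
    using assms by eventually_elim (rule clip_id)
qed (auto simp: measurable_cong_sets[OF reward_sets refl])

lemma discounted_return:
  assumes \<gamma>: "0 \<le> \<gamma>" "\<gamma> < 1" and b: "0 \<le> b" and R: "\<And>x. AE r in R x. \<bar>r\<bar> \<le> b"
  shows "(\<integral>\<omega>. (\<Sum>t. \<gamma> ^ t * snd (\<omega> t)) \<partial>M)
    = (\<Sum>t. \<gamma> ^ t * pmf_mean (state_law t) (reward_mean R))"
proof -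
  have bound: "\<bar>\<gamma> ^ t * clip b r\<bar> \<le> \<gamma> ^ t * b" for t r
    using \<gamma> clip_bound[OF b, of r] by (simp add: abs_mult mult_left_mono)
  have geo: "summable (\<lambda>t. \<gamma> ^ t * b)"
    using \<gamma> by (intro summable_mult2 summable_geometric) simp
  have int: "integrable M (\<lambda>\<omega>. \<gamma> ^ t * clip b (snd (\<omega> t)))" for t
    by (rule integrable_bounded[where c = "\<gamma> ^ t * b"]) (simp_all only: bound, measurable)
  \<comment> \<open>Clipped rewards are bounded on every path, so a geometric series dominates and
    sum and integral may be exchanged.\<close>
  have "(\<integral>\<omega>. (\<Sum>t. \<gamma> ^ t * snd (\<omega> t)) \<partial>M) = (\<integral>\<omega>. (\<Sum>t. \<gamma> ^ t * clip b (snd (\<omega> t))) \<partial>M)"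
  proof (rule integral_cong_AE)
    show "AE \<omega> in M. (\<Sum>t. \<gamma> ^ t * snd (\<omega> t)) = (\<Sum>t. \<gamma> ^ t * clip b (snd (\<omega> t)))"
      using AE_rewards_bounded[OF R] by eventually_elim (simp add: clip_id)
  qed measurable
  also have "\<dots> = (\<Sum>t. \<integral>\<omega>. \<gamma> ^ t * clip b (snd (\<omega> t)) \<partial>M)"
  proof (rule integral_suminf[OF int])
    have "summable (\<lambda>t. norm (\<gamma> ^ t * clip b (snd (\<omega> t))))" for \<omega> :: "nat \<Rightarrow> 'x \<times> real"
      by (rule summable_comparison_test'[OF geo, of 0]) (simp only: real_norm_def abs_idempotent bound)
    then show "AE \<omega> in M. summable (\<lambda>t. norm (\<gamma> ^ t * clip b (snd (\<omega> t))))"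
      by simp
    have "norm (\<integral>\<omega>. norm (\<gamma> ^ t * clip b (snd (\<omega> t))) \<partial>M) \<le> \<gamma> ^ t * b" for t
    proof -
      have "(\<integral>\<omega>. norm (\<gamma> ^ t * clip b (snd (\<omega> t))) \<partial>M) \<le> (\<integral>\<omega>. \<gamma> ^ t * b \<partial>M)"
        using int by (intro integral_mono integrable_norm) (simp_all only: real_norm_def bound M.integrable_const)
      then show ?thesis
        by (simp add: integral_nonneg_AE)
    qed
    then show "summable (\<lambda>t. \<integral>\<omega>. norm (\<gamma> ^ t * clip b (snd (\<omega> t))) \<partial>M)"
      by (intro summable_comparison_test'[OF geo, of 0]) simp
  qed
  also have "\<dots> = (\<Sum>t. \<gamma> ^ t * pmf_mean (state_law t) (reward_mean R))"
  proof (intro suminf_cong)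
    fix t
    have "(\<lambda>y. clip b (snd y)) \<in> borel_measurable (step_space :: ('x \<times> real) measure)"
      by measurable
    then have "(\<integral>\<omega>. clip b (snd (\<omega> t)) \<partial>M) = pmf_mean (state_law t) (reward_mean R)"
      using integral_coord[of "\<lambda>y. clip b (snd y)" b t] clip_bound[OF b]
      by (simp add: integral_clip_reward[OF R])
    then show "(\<integral>\<omega>. \<gamma> ^ t * clip b (snd (\<omega> t)) \<partial>M) = \<gamma> ^ t * pmf_mean (state_law t) (reward_mean R)"
      by simp
  qed
  finally show ?thesis .
qed

lemma abs_reward_mean_le:
  assumes b: "0 \<le> b" and R: "AE r in R x. \<bar>r\<bar> \<le> b"
  shows "\<bar>reward_mean R x\<bar> \<le> b"
proof -
  interpret prob_space "R x" by (rule reward_prob)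
  have i: "integrable (R x) (clip b)"
    by (rule integrable_const_bound[of _ b]) (use clip_bound[OF b] in \<open>auto simp: measurable_cong_sets[OF reward_sets refl]\<close>)
  have "\<bar>\<integral>r. clip b r \<partial>R x\<bar> \<le> (\<integral>r. \<bar>clip b r\<bar> \<partial>R x)" by (rule integral_abs_bound)
  also have "\<dots> \<le> (\<integral>r. b \<partial>R x)"
    using i clip_bound[OF b] by (intro integral_mono integrable_abs) auto
  finally show ?thesis by (simp add: integral_clip_reward[OF R] prob_space)
qed

end

section \<open>Bellman equations\<close>

lemma pmf_mean_sa_kernel:
  fixes P :: "'s::finite \<times> 'a::finite \<Rightarrow> 's pmf"
  shows "pmf_mean (sa_kernel P \<pi> x) u = pmf_mean (P x) (\<lambda>s. pmf_mean (\<pi> s) (\<lambda>a. u (s, a)))"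
  by (simp add: sa_kernel_def with_action_def pmf_mean_bind)

definition bellman ::
  "('s::finite \<times> 'a::finite \<Rightarrow> 's pmf) \<Rightarrow> ('s \<times> 'a \<Rightarrow> real) \<Rightarrow> real \<Rightarrow> real ^ ('s \<times> 'a) \<Rightarrow> 's \<times> 'a \<Rightarrow> real" where
  "bellman P r \<gamma> Q x = r x + \<gamma> * pmf_mean (P x) (\<lambda>s. MAX a. Q $ (s, a))"

lemma pmf_mean_le_Max: "pmf_mean q u \<le> (MAX a. u a)" for u :: "'x::finite \<Rightarrow> real"
  using pmf_mean_mono[of u "\<lambda>_. MAX a. u a" q] by simp

locale bounded_mdp =
  fixes P :: "'s::finite \<times> 'a::finite \<Rightarrow> 's pmf" and R :: "'s \<times> 'a \<Rightarrow> real measure" and \<gamma> b :: real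
  assumes \<gamma>_nonneg: "0 \<le> \<gamma>" and \<gamma>_less: "\<gamma> < 1" and b_nonneg: "0 \<le> b"
    and R_prob: "\<And>x. prob_space (R x)" and R_sets: "\<And>x. sets (R x) = sets borel"
    and R_bounded: "\<And>x. AE r in R x. \<bar>r\<bar> \<le> b"
begin

text \<open>Replaces the path integral by a power series in the transition kernel. The Bellman
  equation for a policy follows by splitting off the first term and exchanging the series with the
  finite sum over the first transition.\<close>

lemma q_fun_series:
  "q_fun P R \<gamma> \<pi> $ x = (\<Sum>t. \<gamma> ^ t * pmf_mean (nstep (sa_kernel P \<pi>) t x) (reward_mean R))"
proof -
  interpret reward_chain R "sa_kernel P \<pi>" "return_pmf x"
    by (rule reward_chain.intro) (rule R_prob R_sets)+
  show ?thesis
    unfolding q_fun_def using discounted_return[OF \<gamma>_nonneg \<gamma>_less b_nonneg R_bounded]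
    by (simp add: state_law_def bind_return_pmf)
qed

lemma abs_reward_mean: "\<bar>reward_mean R x\<bar> \<le> b"
proof -
  \<comment> \<open>Kernel and start are dummies: the bound concerns \<open>R x\<close>
    alone.\<close>
  interpret reward_chain R "\<lambda>x. return_pmf x" "return_pmf x"
    by (rule reward_chain.intro) (rule R_prob R_sets)+
  show ?thesis by (rule abs_reward_mean_le[OF b_nonneg R_bounded])
qed

lemma q_fun_summable:
  "summable (\<lambda>t. \<gamma> ^ t * pmf_mean (nstep (sa_kernel P \<pi>) t x) (reward_mean R))"
proof (rule summable_comparison_test')
  show "summable (\<lambda>t. \<gamma> ^ t * b)"
    using \<gamma>_nonneg \<gamma>_less by (intro summable_mult2 summable_geometric) simp
  show "norm (\<gamma> ^ t * pmf_mean (nstep (sa_kernel P \<pi>) t x) (reward_mean R)) \<le> \<gamma> ^ t * b" if "t \<ge> 0" for t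
    using \<gamma>_nonneg pmf_mean_abs_le[of "reward_mean R" b, OF abs_reward_mean] by (simp add: abs_mult mult_left_mono)
qed

lemma q_fun_bellman:
  "q_fun P R \<gamma> \<pi> $ x = reward_mean R x + \<gamma> * pmf_mean (sa_kernel P \<pi> x) (\<lambda>y. q_fun P R \<gamma> \<pi> $ y)"
proof -
  let ?K = "sa_kernel P \<pi>" and ?r = "reward_mean R"
  let ?f = "\<lambda>x t. \<gamma> ^ t * pmf_mean (nstep ?K t x) ?r"
  have "q_fun P R \<gamma> \<pi> $ x = (\<Sum>t. ?f x (Suc t)) + ?f x 0"
    unfolding q_fun_series using suminf_split_head[OF q_fun_summable, of \<pi> x] by simp
  also have "(\<Sum>t. ?f x (Suc t)) = (\<Sum>t. \<Sum>y\<in>UNIV. \<gamma> * pmf (?K x) y * ?f y t)"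
    by (intro suminf_cong)
       (simp add: nstep_Suc_left pmf_mean_bind pmf_mean_sum[of "?K x"] sum_distrib_left mult_ac del: nstep.simps)
  also have "\<dots> = (\<Sum>y\<in>UNIV. \<Sum>t. \<gamma> * pmf (?K x) y * ?f y t)"
    by (intro suminf_sum summable_mult q_fun_summable)
  also have "\<dots> = (\<Sum>y\<in>UNIV. \<gamma> * pmf (?K x) y * q_fun P R \<gamma> \<pi> $ y)"
    unfolding q_fun_series by (intro sum.cong refl suminf_mult q_fun_summable)
  also have "\<dots> = \<gamma> * pmf_mean (?K x) (\<lambda>y. q_fun P R \<gamma> \<pi> $ y)"
    by (simp add: pmf_mean_sum sum_distrib_left mult_ac)
  finally show ?thesis by simp
qed

text \<open>A minimum principle for subsolutions of the Bellman equation of \<open>\<pi>\<close>. If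
  \<open>m\<close> is the least value of the difference, attained at \<open>y\<close>, then the
  equations at \<open>y\<close> give \<open>m \<ge> \<gamma> m\<close>, hence
  \<open>m \<ge> 0\<close>.\<close>

lemma q_fun_ge:
  assumes Q: "\<And>x. Q x \<le> reward_mean R x + \<gamma> * pmf_mean (sa_kernel P \<pi> x) Q"
  shows "Q x \<le> q_fun P R \<gamma> \<pi> $ x"
proof -
  let ?D = "\<lambda>y. q_fun P R \<gamma> \<pi> $ y - Q y"
  define m where "m = (MIN y. ?D y)"
  have m_le: "m \<le> ?D y" for y
    unfolding m_def by (intro Min_le) auto
  have "m \<in> range ?D"
    unfolding m_def by (intro Min_in) auto
  then obtain y where y: "m = ?D y" by blast
  have "m = pmf_mean (sa_kernel P \<pi> y) (\<lambda>_. m)" by simp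
  also have "\<dots> \<le> pmf_mean (sa_kernel P \<pi> y) ?D"
    by (rule pmf_mean_mono) (rule m_le)
  finally have "\<gamma> * m \<le> \<gamma> * pmf_mean (sa_kernel P \<pi> y) ?D"
    using \<gamma>_nonneg by (rule mult_left_mono)
  also have "\<dots> \<le> m"
    unfolding y pmf_mean_diff using Q[of y] q_fun_bellman[of \<pi> y] by (simp add: algebra_simps)
  finally have "0 \<le> (1 - \<gamma>) * m" by (simp add: algebra_simps)
  then have "0 \<le> m" using \<gamma>_less by (simp add: zero_le_mult_iff)
  then show ?thesis using m_le[of x] by simp
qed

text \<open>Policy improvement: the greedy policy for \<open>Q = Q\<^sup>\<rho>\<close> has a value of at least \<open>F Q \<ge> Q\<close>, and at
  most \<open>Q\<close> since \<open>\<rho>\<close> is optimal.\<close>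

lemma optimal_fixed_point:
  assumes opt: "optimal_policy P R \<gamma> \<rho>"
  shows "bellman P (reward_mean R) \<gamma> (q_fun P R \<gamma> \<rho>) x = q_fun P R \<gamma> \<rho> $ x"
proof -
  let ?Q = "q_fun P R \<gamma> \<rho>" and ?F = "bellman P (reward_mean R) \<gamma> (q_fun P R \<gamma> \<rho>)"
  have "\<exists>a. ?Q $ (s, a) = (MAX a. ?Q $ (s, a))" for s
  proof -
    have "(MAX a. ?Q $ (s, a)) \<in> range (\<lambda>a. ?Q $ (s, a))" by (intro Max_in) auto
    then show ?thesis by (elim imageE) (rule exI, erule sym)
  qed
  then have "\<exists>g. \<forall>s. ?Q $ (s, g s) = (MAX a. ?Q $ (s, a))" by (intro choice allI)
  then obtain g where g: "\<And>s. ?Q $ (s, g s) = (MAX a. ?Q $ (s, a))" by blast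
  let ?\<pi> = "\<lambda>s. return_pmf (g s)"
  have greedy: "?F y = reward_mean R y + \<gamma> * pmf_mean (sa_kernel P ?\<pi> y) (\<lambda>z. ?Q $ z)" for y
    by (simp add: bellman_def pmf_mean_sa_kernel g)
  have Q_le: "?Q $ y \<le> ?F y" for y
    unfolding bellman_def
    unfolding q_fun_bellman[of \<rho> y] pmf_mean_sa_kernel
    by (intro add_mono mult_left_mono pmf_mean_mono pmf_mean_le_Max order_refl \<gamma>_nonneg)
  \<comment> \<open>\<open>?F\<close> is a subsolution for the greedy policy: its kernel turns
    \<open>?Q\<close> into \<open>?F\<close>, and replacing \<open>?Q\<close> by the larger
    \<open>?F\<close> under the expectation only increases the right-hand side.\<close>
  have F_le: "?F y \<le> q_fun P R \<gamma> ?\<pi> $ y" for y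
  proof (rule q_fun_ge)
    fix z
    show "?F z \<le> reward_mean R z + \<gamma> * pmf_mean (sa_kernel P ?\<pi> z) ?F"
      unfolding greedy[of z] by (intro add_mono mult_left_mono pmf_mean_mono Q_le order_refl \<gamma>_nonneg)
  qed
  show ?thesis
  proof (rule antisym)
    have "q_fun P R \<gamma> ?\<pi> $ x \<le> ?Q $ x" using opt unfolding optimal_policy_def by blast
    then show "?F x \<le> ?Q $ x" using F_le[of x] by linarith
  qed (rule Q_le)
qed

end

lemma abs_Max_diff_le:
  fixes u v :: "'x::finite \<Rightarrow> real"
  assumes "\<And>a. \<bar>u a - v a\<bar> \<le> c"
  shows "\<bar>(MAX a. u a) - (MAX a. v a)\<bar> \<le> c"
proof -
  have "(MAX a. u a) \<le> (MAX a. v a) + c" if *: "\<And>a. \<bar>u a - v a\<bar> \<le> c" for u v :: "'x \<Rightarrow> real"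
  proof (rule Max.boundedI)
    fix z assume "z \<in> range u"
    then obtain a where "z = u a" by blast
    moreover have "v a \<le> (MAX a. v a)" by (intro Max_ge) auto
    ultimately show "z \<le> (MAX a. v a) + c" using *[of a] by linarith
  qed auto
  from this[of u v] this[of v u] assms show ?thesis
    by (smt (verit))
qed

lemma abs_bellman_diff_le:
  assumes "0 \<le> \<gamma>" and "\<And>y. \<bar>Q $ y - Q' $ y\<bar> \<le> c"
  shows "\<bar>bellman P r \<gamma> Q x - bellman P r \<gamma> Q' x\<bar> \<le> \<gamma> * c"
proof -
  have "\<bar>pmf_mean (P x) (\<lambda>s. (MAX a. Q $ (s, a)) - (MAX a. Q' $ (s, a)))\<bar> \<le> c"
    using assms by (intro pmf_mean_abs_le abs_Max_diff_le)
  then show ?thesis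
    unfolding bellman_def pmf_mean_diff using assms(1)
    by (simp add: right_diff_distrib[symmetric] abs_mult mult_left_mono)
qed

section \<open>Mixing\<close>

lemma prob_diff_le_tv_dist: "measure_pmf.prob p A - measure_pmf.prob q A \<le> tv_dist p q"
proof -
  have "\<bar>measure_pmf.prob p B - measure_pmf.prob q B\<bar> \<le> 1" for B
    using measure_pmf.prob_le_1[of p B] measure_pmf.prob_le_1[of q B]
      measure_nonneg[of "measure_pmf p" B] measure_nonneg[of "measure_pmf q" B] by linarith
  then have "\<bar>measure_pmf.prob p A - measure_pmf.prob q A\<bar> \<le> tv_dist p q"
    unfolding tv_dist_def by (intro cSUP_upper bdd_aboveI2) auto
  then show ?thesis by linarith
qed

lemma tv_dist_commute: "tv_dist p q = tv_dist q p"
  by (simp add: tv_dist_def abs_minus_commute)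

text \<open>After subtraction of its minimum, \<open>f\<close> takes values between 0 and
  \<open>c\<close>. Only the points where \<open>p\<close> exceeds \<open>q\<close> contribute
  positively, and their total excess is a difference of probabilities of one set. Measuring
  \<open>f\<close> by its oscillation gives the factor \<open>c\<close>.\<close>

lemma pmf_mean_diff_le_tv_dist:
  fixes f :: "'x::finite \<Rightarrow> real"
  assumes f: "\<And>x y. f x - f y \<le> c"
  shows "pmf_mean p f - pmf_mean q f \<le> c * tv_dist p q"
proof -
  define m where "m = (MIN x. f x)"
  have "m \<in> range f" unfolding m_def by (intro Min_in) auto
  then have m: "f x - m \<le> c" for x using f by blast
  have m0: "0 \<le> f x - m" for x unfolding m_def by (simp add: Min_le)
  have c0: "0 \<le> c" using f[of undefined undefined] by simp
  let ?A = "{x. pmf q x < pmf p x}"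
  have 1: "pmf_mean r f = (\<Sum>x\<in>UNIV. pmf r x * (f x - m)) + m" for r
    using sum_pmf_eq_1[of UNIV r] by (simp add: pmf_mean_sum right_diff_distrib sum_subtractf sum_distrib_right[symmetric])
  have "pmf_mean p f - pmf_mean q f = (\<Sum>x\<in>UNIV. (pmf p x - pmf q x) * (f x - m))"
    unfolding 1 by (simp add: left_diff_distrib sum_subtractf)
  also have "\<dots> \<le> (\<Sum>x\<in>UNIV. if x \<in> ?A then (pmf p x - pmf q x) * c else 0)"
    using m m0 by (intro sum_mono) (auto intro: mult_left_mono mult_nonpos_nonneg)
  also have "\<dots> = c * (measure_pmf.prob p ?A - measure_pmf.prob q ?A)"
    by (simp add: sum.If_cases measure_measure_pmf_finite sum_subtractf[symmetric] sum_distrib_left mult.commute)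
  also have "\<dots> \<le> c * tv_dist p q"
    by (intro mult_left_mono prob_diff_le_tv_dist c0)
  finally show ?thesis .
qed

lemma nstep_add: "nstep K (m + n) x = bind_pmf (nstep K m x) (nstep K n)"
proof (induction n)
  case 0
  have "nstep K 0 = return_pmf" by (rule ext) simp
  then show ?case by (simp add: bind_return_pmf')
qed (simp add: bind_assoc_pmf)

text \<open>Both starting points are compared with \<open>\<mu>\<close>, at the cost of a quarter of
  the oscillation each.\<close>

lemma mixed_at_contracts:
  fixes f :: "'x::finite \<Rightarrow> real"
  assumes mix: "mixed_at K \<mu> t" and f: "\<And>x y. f x - f y \<le> c"
  shows "pmf_mean (nstep K t x) f - pmf_mean (nstep K t y) f \<le> c / 2"
proof -
  have c0: "0 \<le> c" using f[of undefined undefined] by simp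
  have tv: "tv_dist (nstep K t z) \<mu> \<le> 1 / 4" for z
    using mix unfolding mixed_at_def by blast
  have "pmf_mean (nstep K t x) f - pmf_mean \<mu> f \<le> c * tv_dist (nstep K t x) \<mu>"
    by (rule pmf_mean_diff_le_tv_dist[OF f])
  moreover have "pmf_mean \<mu> f - pmf_mean (nstep K t y) f \<le> c * tv_dist (nstep K t y) \<mu>"
    unfolding tv_dist_commute[of _ \<mu>] by (rule pmf_mean_diff_le_tv_dist[OF f])
  moreover have "c * tv_dist (nstep K t x) \<mu> \<le> c * (1 / 4)" "c * tv_dist (nstep K t y) \<mu> \<le> c * (1 / 4)"
    by (intro mult_left_mono tv c0)+
  ultimately show ?thesis by linarith
qed

text \<open>The bound for one block is applied to the function already averaged over
  \<open>k\<close> blocks, whose oscillation is at most \<open>c / 2 ^ k\<close>. Working with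
  oscillations makes the iteration immediate, where distances to \<open>\<mu>\<close> would need a
  separate submultiplicativity argument.\<close>

lemma mixed_at_contracts_iterated:
  fixes f :: "'x::finite \<Rightarrow> real"
  assumes mix: "mixed_at K \<mu> t" and f: "\<And>x y. f x - f y \<le> c"
  shows "pmf_mean (nstep K (k * t) x) f - pmf_mean (nstep K (k * t) y) f \<le> c / 2 ^ k"
proof (induction k arbitrary: x y)
  case (Suc k)
  show ?case
    using mixed_at_contracts[OF mix, where f = "\<lambda>x. pmf_mean (nstep K (k * t) x) f", OF Suc, of x y]
    by (simp add: nstep_add pmf_mean_bind)
qed (simp add: f)

lemma stationary_nstep: "stationary K \<mu> \<Longrightarrow> bind_pmf \<mu> (nstep K n) = \<mu>"
proof (induction n)
  case 0
  have "nstep K 0 = return_pmf" by (rule ext) simp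
  then show ?case by (simp add: bind_return_pmf')
next
  case (Suc n)
  then show ?case
    by (simp add: bind_assoc_pmf[symmetric] stationary_def)
qed

text \<open>By stationarity \<open>pmf \<mu> i\<close> is the average over all starting points of
  the probability of being at \<open>i\<close>, and none of these exceeds the one from
  \<open>x\<close> by more than \<open>1 / 2 ^ k\<close>, since the indicator of \<open>i\<close>
  has oscillation 1.\<close>

lemma nstep_lower_bound:
  fixes \<mu> :: "'x::finite pmf"
  assumes mix: "mixed_at K \<mu> t" and st: "stationary K \<mu>"
  shows "pmf (nstep K (k * t) x) i \<ge> pmf \<mu> i - 1 / 2 ^ k"
proof -
  let ?f = "\<lambda>y. if y = i then 1 else 0 :: real"
  have pmf_eq: "pmf_mean q ?f = pmf q i" for q
    by (simp add: pmf_mean_sum if_distrib cong: if_cong)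
  have "pmf \<mu> i = pmf_mean (bind_pmf \<mu> (nstep K (k * t))) ?f"
    by (simp only: stationary_nstep[OF st] pmf_eq)
  also have "\<dots> = pmf_mean \<mu> (\<lambda>y. pmf_mean (nstep K (k * t) y) ?f)"
    by (rule pmf_mean_bind)
  also have "\<dots> \<le> pmf_mean \<mu> (\<lambda>y. pmf_mean (nstep K (k * t) x) ?f + 1 / 2 ^ k)"
    using mixed_at_contracts_iterated[OF mix, where f = ?f and c = 1 and k = k and y = x]
    by (intro pmf_mean_mono) (simp add: algebra_simps)
  finally show ?thesis by (simp add: pmf_eq)
qed


section \<open>Shifted martingale differences\<close>

lemma cosh_le_exp_square: "cosh s \<le> exp (s\<^sup>2 / 2)" for s :: real
proof -
  have *: "cosh s \<le> exp (s\<^sup>2 / 2)" if "0 \<le> s" for s :: real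
  proof -
    have eq: "cosh s = exp (- s) * (1 + 1 / 2 * (exp (2 * s) - 1))"
      by (simp add: cosh_def field_simps flip: exp_add)
    have pos: "0 < 1 + 1 / 2 * (exp (2 * s) - 1)"
      using that by (simp add: add_pos_nonneg)
    \<comment> \<open>Hoeffding's estimate for a fair sign: probability 1/2 and a range of length
      \<open>2 * s\<close>.\<close>
    have "- (2 * s) * (1 / 2) + ln (1 + 1 / 2 * (exp (2 * s) - 1)) \<le> (2 * s)\<^sup>2 / 8"
      using that by (intro Hoeffdings_lemma_aux) auto
    then have "ln (cosh s) \<le> s\<^sup>2 / 2"
      using pos unfolding eq by (subst ln_mult) (auto simp: power_mult_distrib)
    then show ?thesis
      by (metis exp_le_cancel_iff exp_ln cosh_real_pos)
  qed
  show ?thesis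
    using *[of s] *[of "- s"] by (cases "0 \<le> s") auto
qed

text \<open>Convexity of \<open>exp\<close> between \<open>- s\<close> and \<open>s\<close>. The
  right-hand side is affine in \<open>x\<close>, so that a centred \<open>x\<close> drops out on
  integration and leaves the factor \<open>cosh s\<close>.\<close>

lemma exp_le_chord:
  fixes x s :: real
  assumes "\<bar>x\<bar> \<le> 1"
  shows "exp (s * x) \<le> cosh s + x * sinh s"
proof -
  have "exp ((1 - (1 + x) / 2) *\<^sub>R (- s) + ((1 + x) / 2) *\<^sub>R s)
      \<le> (1 - (1 + x) / 2) * exp (- s) + (1 + x) / 2 * exp s"
    using assms by (intro convex_onD[OF exp_convex]) auto
  then show ?thesis
    by (simp add: cosh_def sinh_def field_simps)
qed

context reward_chain
begin

text \<open>
  A shifted martingale difference \<open>e k\<close> becomes an ordinary one along each residue class modulo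
  \<open>\<tau> + 1\<close>, since \<open>e (k - \<tau> - 1)\<close> is a function of the history up to time \<open>k - \<tau>\<close>.
\<close>

lemma exp_moment_residue_class:
  fixes e :: "nat \<Rightarrow> (nat \<Rightarrow> 'x \<times> real) \<Rightarrow> real" and a :: "nat \<Rightarrow> real"
  assumes meas: "\<And>k. e k \<in> borel_measurable path_space"
    and adapted: "\<And>k. depends_before (k + 2) (e k)"
    and bound: "\<And>k \<omega>. \<bar>e k \<omega>\<bar> \<le> c" and c: "0 < c"
    and init: "\<And>k \<omega>. k < \<tau> \<Longrightarrow> e k \<omega> = 0"
    and orth: "\<And>k g B. \<tau> \<le> k \<Longrightarrow> g \<in> borel_measurable path_space \<Longrightarrow> depends_before (Suc (k - \<tau>)) g \<Longrightarrow>
      (\<And>\<omega>. \<bar>g \<omega>\<bar> \<le> B) \<Longrightarrow> (\<integral>\<omega>. g \<omega> * e k \<omega> \<partial>M) = 0"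
    and residue: "\<And>k. a k \<noteq> 0 \<Longrightarrow> k mod (\<tau> + 1) = j"
  shows "(\<integral>\<omega>. exp (\<Sum>k<n. a k * e k \<omega>) \<partial>M) \<le> exp (c\<^sup>2 / 2 * (\<Sum>k<n. (a k)\<^sup>2))"
proof (induction n)
  case (Suc n)
  let ?S = "\<lambda>\<omega>. \<Sum>k<n. a k * e k \<omega>"
  have mono: "(\<integral>\<omega>. exp (?S \<omega>) \<partial>M) \<le> exp (c\<^sup>2 / 2 * (\<Sum>k<Suc n. (a k)\<^sup>2))"
    by (rule order_trans[OF Suc]) (simp add: algebra_simps)
  show ?case
  proof (cases "a n = 0 \<or> n < \<tau>")
    case True
    then have "a n * e n \<omega> = 0" for \<omega> using init by auto
    then have "(\<Sum>k<Suc n. a k * e k \<omega>) = ?S \<omega>" for \<omega> by simp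
    then show ?thesis using mono by (simp only:)
  next
    case False
    then have n: "\<tau> \<le> n" and an: "a n \<noteq> 0" by auto
    \<comment> \<open>Distinct indices of one residue class are at least \<open>\<tau> + 1\<close>
      apart, so the last \<open>\<tau>\<close> terms before \<open>n\<close> vanish. Each remaining
      \<open>e k\<close> looks at \<open>k + 2\<close> coordinates, at most
      \<open>n - \<tau> + 1\<close> of them, which is exactly what \<open>orth\<close> admits in a
      test function.\<close>
    have S_eq: "?S \<omega> = (\<Sum>k<n - \<tau>. a k * e k \<omega>)" for \<omega>
    proof -
      have "a k = 0" if "k \<in> {..<n} - {..<n - \<tau>}" for k
      proof (rule ccontr)
        assume "a k \<noteq> 0"
        then have eq: "n mod (\<tau> + 1) = k mod (\<tau> + 1)" using residue an by metis
        have "k \<le> n" "n - k < \<tau> + 1" "0 < n - k" using that by auto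
        moreover have "(\<tau> + 1) dvd n - k" using eq \<open>k \<le> n\<close> by (metis mod_eq_dvd_iff_nat)
        ultimately show False using nat_dvd_not_less by blast
      qed
      then show ?thesis
        by (intro sum.mono_neutral_right) auto
    qed
    have dep: "depends_before (Suc (n - \<tau>)) (\<lambda>\<omega>. exp (?S \<omega>))"
    proof -
      have "depends_before (Suc (n - \<tau>)) (e k)" if "k < n - \<tau>" for k
        using that by (intro depends_before_mono[OF adapted]) simp
      then have "e k \<omega> = e k \<omega>'" if "\<forall>i<Suc (n - \<tau>). \<omega> i = \<omega>' i" "k < n - \<tau>" for k \<omega> \<omega>'
        using that unfolding depends_before_def by blast
      then show ?thesis
        unfolding S_eq depends_before_def
        by (intro allI impI arg_cong[where f = exp] sum.cong refl arg_cong[where f = "(*) _"]) auto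
    qed
    have S_meas [measurable]: "?S \<in> borel_measurable path_space"
      using meas by measurable
    have S_bound: "\<bar>?S \<omega>\<bar> \<le> (\<Sum>k<n. \<bar>a k\<bar> * c)" for \<omega>
      by (rule order_trans[OF sum_abs]) (intro sum_mono, simp add: abs_mult mult_left_mono bound)
    then have exp_bound: "\<bar>exp (?S \<omega>)\<bar> \<le> exp (\<Sum>k<n. \<bar>a k\<bar> * c)" for \<omega>
      using abs_le_D1[OF S_bound] by simp
    note [measurable] = meas
    have int1: "integrable M (\<lambda>\<omega>. exp (?S \<omega>))"
      by (rule integrable_bounded[OF _ exp_bound]) measurable
    have int2: "integrable M (\<lambda>\<omega>. exp (?S \<omega>) * e n \<omega>)"
    proof (rule integrable_bounded)
      show "\<bar>exp (?S \<omega>) * e n \<omega>\<bar> \<le> exp (\<Sum>k<n. \<bar>a k\<bar> * c) * c" for \<omega>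
        unfolding abs_mult by (intro mult_mono exp_bound bound) auto
    qed measurable
    have int3: "integrable M (\<lambda>\<omega>. exp (?S \<omega> + a n * e n \<omega>))"
    proof (rule integrable_bounded)
      have "\<bar>a n * e n \<omega>\<bar> \<le> \<bar>a n\<bar> * c" for \<omega>
        by (simp add: abs_mult mult_left_mono bound)
      then show "\<bar>exp (?S \<omega> + a n * e n \<omega>)\<bar> \<le> exp ((\<Sum>k<n. \<bar>a k\<bar> * c) + \<bar>a n\<bar> * c)" for \<omega>
        using add_mono[OF abs_le_D1[OF S_bound] abs_le_D1, of "a n * e n \<omega>" "\<bar>a n\<bar> * c" \<omega>] by simp
    qed measurable
    let ?s = "a n * c"
    have step: "exp (a n * e n \<omega>) \<le> cosh ?s + e n \<omega> * (sinh ?s / c)" for \<omega>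
      using exp_le_chord[of "e n \<omega> / c" ?s] bound[of n \<omega>] c by (simp add: field_simps)
    have "(\<integral>\<omega>. exp (\<Sum>k<Suc n. a k * e k \<omega>) \<partial>M)
        \<le> (\<integral>\<omega>. cosh ?s * exp (?S \<omega>) + (sinh ?s / c) * (exp (?S \<omega>) * e n \<omega>) \<partial>M)"
    proof (rule integral_mono)
      show "exp (\<Sum>k<Suc n. a k * e k \<omega>) \<le> cosh ?s * exp (?S \<omega>) + (sinh ?s / c) * (exp (?S \<omega>) * e n \<omega>)" for \<omega>
        using mult_left_mono[OF step[of \<omega>], of "exp (?S \<omega>)"] by (simp add: exp_add algebra_simps)
    qed (use int1 int2 int3 in simp_all)
    also have "\<dots> = cosh ?s * (\<integral>\<omega>. exp (?S \<omega>) \<partial>M) + (sinh ?s / c) * (\<integral>\<omega>. exp (?S \<omega>) * e n \<omega> \<partial>M)"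
      using int1 int2 by simp
    also have "(\<integral>\<omega>. exp (?S \<omega>) * e n \<omega> \<partial>M) = 0"
      by (rule orth[OF n _ dep exp_bound]) measurable
    also have "cosh ?s * (\<integral>\<omega>. exp (?S \<omega>) \<partial>M) + (sinh ?s / c) * 0
        \<le> exp (?s\<^sup>2 / 2) * exp (c\<^sup>2 / 2 * (\<Sum>k<n. (a k)\<^sup>2))"
      using Suc cosh_le_exp_square[of ?s] cosh_real_nonneg[of ?s]
      by (simp add: mult_mono integral_nonneg_AE)
    also have "\<dots> = exp (c\<^sup>2 / 2 * (\<Sum>k<Suc n. (a k)\<^sup>2))"
      by (simp add: exp_add[symmetric] algebra_simps power_mult_distrib)
    finally show ?thesis .
  qed
qed simp

text \<open>Markov's inequality for \<open>exp (l * S)\<close>. The threshold is written so that the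
  bound is \<open>exp (- L)\<close> for every \<open>l\<close>; the choice of \<open>l\<close> is
  left until the residue classes are put together.\<close>

lemma tail_residue_class:
  fixes e :: "nat \<Rightarrow> (nat \<Rightarrow> 'x \<times> real) \<Rightarrow> real" and a :: "nat \<Rightarrow> real"
  assumes meas: "\<And>k. e k \<in> borel_measurable path_space"
    and adapted: "\<And>k. depends_before (k + 2) (e k)"
    and bound: "\<And>k \<omega>. \<bar>e k \<omega>\<bar> \<le> c" and c: "0 < c"
    and init: "\<And>k \<omega>. k < \<tau> \<Longrightarrow> e k \<omega> = 0"
    and orth: "\<And>k g B. \<tau> \<le> k \<Longrightarrow> g \<in> borel_measurable path_space \<Longrightarrow> depends_before (Suc (k - \<tau>)) g \<Longrightarrow>
      (\<And>\<omega>. \<bar>g \<omega>\<bar> \<le> B) \<Longrightarrow> (\<integral>\<omega>. g \<omega> * e k \<omega> \<partial>M) = 0"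
    and residue: "\<And>k. a k \<noteq> 0 \<Longrightarrow> k mod (\<tau> + 1) = j"
    and l: "0 < l"
  shows "M.prob {\<omega>. (\<Sum>k<n. a k * e k \<omega>) \<ge> l * c\<^sup>2 / 2 * (\<Sum>k<n. (a k)\<^sup>2) + L / l} \<le> exp (- L)"
proof -
  note [measurable] = meas
  let ?S = "\<lambda>\<omega>. \<Sum>k<n. a k * e k \<omega>" and ?V = "\<Sum>k<n. (a k)\<^sup>2"
  let ?u = "l * c\<^sup>2 / 2 * ?V + L / l"
  have moment: "(\<integral>\<omega>. exp (l * ?S \<omega>) \<partial>M) \<le> exp (c\<^sup>2 / 2 * (l\<^sup>2 * ?V))"
  proof -
    have "(\<integral>\<omega>. exp (\<Sum>k<n. (l * a k) * e k \<omega>) \<partial>M) \<le> exp (c\<^sup>2 / 2 * (\<Sum>k<n. (l * a k)\<^sup>2))"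
      by (rule exp_moment_residue_class[OF meas adapted bound c init orth, where j = j]) (use residue in auto)
    then show ?thesis
      by (simp only: sum_distrib_left power_mult_distrib mult.assoc)
  qed
  have S_bound: "\<bar>?S \<omega>\<bar> \<le> (\<Sum>k<n. \<bar>a k\<bar> * c)" for \<omega>
    by (rule order_trans[OF sum_abs]) (intro sum_mono, simp add: abs_mult mult_left_mono bound)
  have int: "integrable M (\<lambda>\<omega>. exp (l * ?S \<omega>))"
  proof (rule integrable_bounded)
    have "l * ?S \<omega> \<le> l * (\<Sum>k<n. \<bar>a k\<bar> * c)" for \<omega>
      using S_bound[of \<omega>] l by (intro mult_left_mono) auto
    then show "\<bar>exp (l * ?S \<omega>)\<bar> \<le> exp (l * (\<Sum>k<n. \<bar>a k\<bar> * c))" for \<omega> by simp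
  qed measurable
  have "{\<omega>. ?S \<omega> \<ge> ?u} = {\<omega> \<in> space M. exp (l * ?S \<omega>) \<ge> exp (l * ?u)}"
    using l by simp
  then have "M.prob {\<omega>. ?S \<omega> \<ge> ?u} \<le> (\<integral>\<omega>. exp (l * ?S \<omega>) \<partial>M) / exp (l * ?u)"
    using integral_Markov_inequality_measure[OF int, where A = "{}" and c = "exp (l * ?u)"] by simp
  also have "\<dots> \<le> exp (c\<^sup>2 / 2 * (l\<^sup>2 * ?V)) / exp (l * ?u)"
    using moment by (intro divide_right_mono) auto
  also have "\<dots> = exp (- L)"
    using l by (simp add: exp_diff[symmetric] power2_eq_square field_simps)
  finally show ?thesis .
qed

text \<open>The same \<open>l\<close> serves all residue classes, so that the variance terms of the classes add up to
  the total variance and no Cauchy-Schwarz step is needed.\<close>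

lemma shifted_azuma:
  fixes e :: "nat \<Rightarrow> (nat \<Rightarrow> 'x \<times> real) \<Rightarrow> real" and a :: "nat \<Rightarrow> real"
  assumes meas: "\<And>k. e k \<in> borel_measurable path_space"
    and adapted: "\<And>k. depends_before (k + 2) (e k)"
    and bound: "\<And>k \<omega>. \<bar>e k \<omega>\<bar> \<le> c" and c: "0 < c"
    and init: "\<And>k \<omega>. k < \<tau> \<Longrightarrow> e k \<omega> = 0"
    and orth: "\<And>k g B. \<tau> \<le> k \<Longrightarrow> g \<in> borel_measurable path_space \<Longrightarrow> depends_before (Suc (k - \<tau>)) g \<Longrightarrow>
      (\<And>\<omega>. \<bar>g \<omega>\<bar> \<le> B) \<Longrightarrow> (\<integral>\<omega>. g \<omega> * e k \<omega> \<partial>M) = 0"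
    and V: "(\<Sum>k<n. (a k)\<^sup>2) \<le> V" "0 < V" and L: "0 < L"
  shows "M.prob {\<omega>. \<bar>\<Sum>k<n. a k * e k \<omega>\<bar> > c * sqrt (2 * real (\<tau> + 1) * V * L)} \<le> 2 * real (\<tau> + 1) * exp (- L)"
proof -
  note [measurable] = meas
  define m where "m = real (\<tau> + 1)"
  have m: "0 < m" by (simp add: m_def)
  \<comment> \<open>The minimizer of \<open>l * c\<^sup>2 / 2 * V + m * L / l\<close>, the sum of
    the thresholds of all \<open>m\<close> classes. At this \<open>l\<close> both terms are
    equal.\<close>
  define l where "l = sqrt (2 * m * L / (c\<^sup>2 * V))"
  have l: "0 < l" using m L c V by (simp add: l_def)
  define A where "A j k = (if k mod (\<tau> + 1) = j then a k else 0)" for j k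
  \<comment> \<open>The sign \<open>s\<close>, which is 1 or -1, treats both tails with one family
    of events and accounts for the factor 2 in the conclusion.\<close>
  define bad where "bad j s = {\<omega>. (\<Sum>k<n. (s * A j k) * e k \<omega>) \<ge> l * c\<^sup>2 / 2 * (\<Sum>k<n. (s * A j k)\<^sup>2) + L / l}" for j :: nat and s :: real
  have "bad j s = {\<omega> \<in> space path_space. (\<Sum>k<n. (s * A j k) * e k \<omega>) \<ge> l * c\<^sup>2 / 2 * (\<Sum>k<n. (s * A j k)\<^sup>2) + L / l}" for j s
    by (simp add: bad_def)
  then have bad_sets: "bad j s \<in> M.events" for j s
    by (simp only: sets_M) measurable
  have tail: "M.prob (bad j s) \<le> exp (- L)" for j s
    unfolding bad_def
    by (rule tail_residue_class[OF meas adapted bound c init orth _ l, where j = j]) (auto simp: A_def split: if_splits)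
  have split: "(\<Sum>k<n. f k) = (\<Sum>j<\<tau> + 1. \<Sum>k<n. if k mod (\<tau> + 1) = j then f k else 0)" for f :: "nat \<Rightarrow> real"
    by (subst sum.swap) (simp add: sum.delta del: sum.lessThan_Suc)
  have one_sided: "(\<Sum>k<n. s * a k * e k \<omega>) \<le> c * sqrt (2 * m * V * L)"
    if "\<And>j. j < \<tau> + 1 \<Longrightarrow> \<omega> \<notin> bad j s" and s: "s\<^sup>2 = 1" for \<omega> s
  proof -
    have "(\<Sum>k<n. s * a k * e k \<omega>) = (\<Sum>j<\<tau> + 1. \<Sum>k<n. (s * A j k) * e k \<omega>)"
      by (subst split, intro sum.cong refl) (auto simp: A_def)
    also have "\<dots> \<le> (\<Sum>j<\<tau> + 1. l * c\<^sup>2 / 2 * (\<Sum>k<n. (s * A j k)\<^sup>2) + L / l)"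
      using that by (intro sum_mono) (auto simp: bad_def not_le less_imp_le)
    also have "\<dots> = l * c\<^sup>2 / 2 * (\<Sum>j<\<tau> + 1. \<Sum>k<n. (s * A j k)\<^sup>2) + m * (L / l)"
      unfolding sum.distrib sum_distrib_left[symmetric] by (simp add: m_def)
    also have "(\<Sum>j<\<tau> + 1. \<Sum>k<n. (s * A j k)\<^sup>2) = (\<Sum>k<n. (a k)\<^sup>2)"
      unfolding split[of "\<lambda>k. (a k)\<^sup>2"] by (intro sum.cong refl) (auto simp: A_def power_mult_distrib s)
    also have "l * c\<^sup>2 / 2 * (\<Sum>k<n. (a k)\<^sup>2) + m * (L / l) \<le> l * c\<^sup>2 / 2 * V + m * (L / l)"
      using V l by (intro add_right_mono mult_left_mono) auto
    also have "\<dots> = c * sqrt (2 * m * V * L)"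
    proof -
      have l2: "l * l = 2 * m * L / (c\<^sup>2 * V)"
        unfolding l_def using m L c V by (simp add: real_sqrt_mult_self)
      have "sqrt (2 * m * V * L) = sqrt ((l * c * V)\<^sup>2)"
        using l2 c V by (simp add: power2_eq_square field_simps)
      also have "\<dots> = l * c * V" using l c V by simp
      finally have "sqrt (2 * m * V * L) = l * c * V" .
      moreover have "m * (L / l) = l * c\<^sup>2 * V / 2"
        using l2 l c V by (simp add: field_simps)
      moreover have "l * c\<^sup>2 / 2 * V + l * c\<^sup>2 * V / 2 = c * (l * c * V)"
        by (simp add: power2_eq_square)
      ultimately show ?thesis by (simp only:)
    qed
    finally show ?thesis .
  qed
  have sub: "{\<omega>. \<bar>\<Sum>k<n. a k * e k \<omega>\<bar> > c * sqrt (2 * m * V * L)} \<subseteq> (\<Union>js\<in>{..<\<tau> + 1} \<times> {1, -1}. bad (fst js) (snd js))"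
  proof
    fix \<omega> assume *: "\<omega> \<in> {\<omega>. \<bar>\<Sum>k<n. a k * e k \<omega>\<bar> > c * sqrt (2 * m * V * L)}"
    show "\<omega> \<in> (\<Union>js\<in>{..<\<tau> + 1} \<times> {1, -1}. bad (fst js) (snd js))"
    proof (rule ccontr)
      assume "\<not> ?thesis"
      then have "\<omega> \<notin> bad j 1" "\<omega> \<notin> bad j (- 1)" if "j < \<tau> + 1" for j using that by auto
      then show False
        using one_sided[of \<omega> 1] one_sided[of \<omega> "- 1"] * by (simp add: sum_negf abs_if split: if_splits)
    qed
  qed
  have "M.prob {\<omega>. \<bar>\<Sum>k<n. a k * e k \<omega>\<bar> > c * sqrt (2 * m * V * L)}
      \<le> M.prob (\<Union>js\<in>{..<\<tau> + 1} \<times> {1, -1}. bad (fst js) (snd js))"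
    by (intro M.finite_measure_mono sub sets.finite_UN) (auto simp: bad_sets)
  also have "\<dots> \<le> (\<Sum>js\<in>{..<\<tau> + 1} \<times> {1, -1}. M.prob (bad (fst js) (snd js)))"
    by (intro M.finite_measure_subadditive_finite) (auto simp: bad_sets)
  also have "\<dots> \<le> (\<Sum>js\<in>{..<\<tau> + 1} \<times> {1, -1 :: real}. exp (- L))"
    by (intro sum_mono tail)
  also have "\<dots> = 2 * real (\<tau> + 1) * exp (- L)"
    by (simp add: card_cartesian_product)
  finally show ?thesis by (simp add: m_def algebra_simps)
qed

end

section \<open>Error recursion\<close>

text \<open>The coefficients found by unrolling the recursion of the noise average: the contribution
  of step \<open>k\<close> is damped once by each later step before \<open>t\<close>.\<close>

definition step_weight :: "real \<Rightarrow> (nat \<Rightarrow> real) \<Rightarrow> nat \<Rightarrow> nat \<Rightarrow> real" where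
  "step_weight \<sigma> \<alpha> t k = \<alpha> k * (\<Prod>l\<in>{k<..<t}. 1 - \<alpha> l * \<sigma>)"

lemma step_weight_Suc: "k < t \<Longrightarrow> step_weight \<sigma> \<alpha> (Suc t) k = (1 - \<alpha> t * \<sigma>) * step_weight \<sigma> \<alpha> t k"
proof -
  assume "k < t"
  then have "{k<..<Suc t} = insert t {k<..<t}" by auto
  then show ?thesis by (simp add: step_weight_def)
qed

lemma step_weight_last: "step_weight \<sigma> \<alpha> (Suc t) t = \<alpha> t"
proof -
  have "{t<..<Suc t} = {}" by auto
  then show ?thesis by (simp add: step_weight_def)
qed

lemma sum_step_weight_Suc:
  "(\<Sum>k<Suc t. step_weight \<sigma> \<alpha> (Suc t) k * e k) = (1 - \<alpha> t * \<sigma>) * (\<Sum>k<t. step_weight \<sigma> \<alpha> t k * e k) + \<alpha> t * e t"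
  by (simp add: step_weight_last step_weight_Suc sum_distrib_left mult.assoc)

text \<open>Induction on \<open>t\<close>. With \<open>u = t + t\<^sub>0\<close> and
  \<open>q = h \<sigma> / u\<close> the step amounts to
  \<open>((1 - q)\<^sup>2 + q) (u + 1) \<le> u\<close>. As \<open>q \<le> 1 / 4\<close>, the first
  factor is at most \<open>1 - 3 / 4 q\<close>, and \<open>q u = h \<sigma> \<ge> 2\<close> makes
  \<open>3 / 4 q (u + 1)\<close> at least 1.\<close>

lemma sum_step_weight_square_le:
  fixes t\<^sub>0 \<sigma> h :: real
  assumes \<sigma>: "0 < \<sigma>" "\<sigma> \<le> 1" and h: "2 \<le> h * \<sigma>" and t0: "4 * h \<le> t\<^sub>0"
  shows "(\<Sum>k<t. (step_weight \<sigma> (\<lambda>t. h / (t + t\<^sub>0)) t k)\<^sup>2) \<le> h / \<sigma> / (t + t\<^sub>0)"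
proof -
  have "0 < h * \<sigma>" using h by linarith
  then have h0: "0 < h" using \<sigma> by (simp add: zero_less_mult_iff)
  let ?\<alpha> = "\<lambda>t::nat. h / (t + t\<^sub>0)"
  show ?thesis
  proof (induction t)
    case 0
    show ?case using h0 \<sigma> t0 by simp
  next
    case (Suc t)
    define u where "u = real t + t\<^sub>0"
    define q where "q = h * \<sigma> / u"
    have u: "0 < u" "4 * h \<le> u" using h0 t0 by (auto simp: u_def)
    have "h * \<sigma> \<le> h" using h0 \<sigma> by simp
    then have "4 * (h * \<sigma>) \<le> u" using u by linarith
    then have q: "0 < q" "q \<le> 1 / 4" using u h0 \<sigma> by (auto simp: q_def pos_divide_le_eq)
    have "(\<Sum>k<Suc t. (step_weight \<sigma> ?\<alpha> (Suc t) k)\<^sup>2)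
        = (1 - ?\<alpha> t * \<sigma>)\<^sup>2 * (\<Sum>k<t. (step_weight \<sigma> ?\<alpha> t k)\<^sup>2) + (?\<alpha> t)\<^sup>2"
      by (simp add: step_weight_last step_weight_Suc sum_distrib_left power_mult_distrib)
    also have "\<dots> \<le> (1 - ?\<alpha> t * \<sigma>)\<^sup>2 * (h / \<sigma> / (t + t\<^sub>0)) + (?\<alpha> t)\<^sup>2"
      by (intro add_right_mono mult_left_mono Suc) simp
    also have "\<dots> = h / \<sigma> * ((1 - q)\<^sup>2 / u + q / u)"
    proof -
      have "h / u * \<sigma> = q" by (simp add: q_def)
      moreover have "(h / u)\<^sup>2 = h / \<sigma> * (q / u)"
        using \<sigma> by (simp add: q_def power2_eq_square)
      ultimately show ?thesis
        unfolding u_def[symmetric] by (simp add: distrib_left)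
    qed
    also have "\<dots> \<le> h / \<sigma> * (1 / (u + 1))"
    proof (intro mult_left_mono)
      have "(1 - q)\<^sup>2 \<le> 1 - 7 / 4 * q"
        using q mult_left_mono[of q "1/4" q] by (simp add: power2_eq_square algebra_simps)
      then have "((1 - q)\<^sup>2 + q) * (u + 1) \<le> (1 - 3 / 4 * q) * (u + 1)"
        using u by (intro mult_right_mono) auto
      also have "\<dots> \<le> u"
      proof -
        have "q * u = h * \<sigma>" using u by (simp add: q_def)
        then show ?thesis using h q by (simp add: algebra_simps)
      qed
      finally have "((1 - q)\<^sup>2 + q) / u \<le> 1 / (u + 1)"
        using u by (simp add: field_simps)
      then show "(1 - q)\<^sup>2 / u + q / u \<le> 1 / (u + 1)" by (simp add: add_divide_distrib)
    qed (use h0 \<sigma> in simp)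
    finally show ?case by (simp add: u_def add_ac)
  qed
qed

text \<open>
  The coefficient \<open>d\<close> of the drift is only known to lie in \<open>[\<sigma>, 1]\<close>. Since the noise average \<open>N\<close> is
  damped at the deterministic rate \<open>\<sigma>\<close>, the recursion for \<open>z = y - N\<close> has an extra term
  \<open>\<alpha> (d - \<sigma>) N\<close>, which the drift absorbs.
\<close>

lemma error_step:
  fixes z N F d \<phi> b n \<Phi> \<alpha> \<sigma> \<gamma> :: real
  assumes z: "\<bar>z\<bar> \<le> b" and N: "\<bar>N\<bar> \<le> n" and F: "\<bar>F\<bar> \<le> \<gamma> * (b + n)" and \<phi>: "\<bar>\<phi>\<bar> \<le> \<Phi>"
    and d: "\<sigma> \<le> d" "d \<le> 1" "0 \<le> \<sigma>" and \<alpha>: "0 \<le> \<alpha>" "\<alpha> \<le> 1"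
    and drift: "0 \<le> (1 - \<gamma>) * b - (1 + \<gamma>) * n"
  shows "\<bar>(z + N + \<alpha> * (d * (F - (z + N)) + \<epsilon> + \<phi>)) - ((1 - \<alpha> * \<sigma>) * N + \<alpha> * \<epsilon>)\<bar>
    \<le> b - \<alpha> * \<sigma> * ((1 - \<gamma>) * b - (1 + \<gamma>) * n) + \<alpha> * \<Phi>"
proof -
  have n0: "0 \<le> n" using N by linarith
  have \<alpha>d: "0 \<le> \<alpha> * d" "\<alpha> * d \<le> 1" using \<alpha> d by (auto intro: mult_le_one)
  have "(z + N + \<alpha> * (d * (F - (z + N)) + \<epsilon> + \<phi>)) - ((1 - \<alpha> * \<sigma>) * N + \<alpha> * \<epsilon>)
      = (1 - \<alpha> * d) * z + \<alpha> * d * F - \<alpha> * (d - \<sigma>) * N + \<alpha> * \<phi>"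
    by (simp add: algebra_simps)
  moreover have "\<bar>(1 - \<alpha> * d) * z\<bar> \<le> (1 - \<alpha> * d) * b"
    using \<alpha>d z by (simp add: abs_mult mult_left_mono)
  moreover have "\<bar>\<alpha> * d * F\<bar> \<le> \<alpha> * d * (\<gamma> * (b + n))"
    unfolding abs_mult[of "\<alpha> * d"] using \<alpha>d F by (simp add: mult_left_mono)
  \<comment> \<open>Bounding \<open>d - \<sigma>\<close> by \<open>d\<close> lets the noise share
    the factor \<open>\<alpha> d\<close> with the drift.\<close>
  moreover have "\<bar>\<alpha> * (d - \<sigma>) * N\<bar> \<le> \<alpha> * d * n"
  proof -
    have "\<bar>\<alpha> * (d - \<sigma>) * N\<bar> = \<alpha> * (d - \<sigma>) * \<bar>N\<bar>" using \<alpha> d by (simp add: abs_mult)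
    also have "\<dots> \<le> \<alpha> * d * n" using \<alpha> d N n0 by (intro mult_mono) auto
    finally show ?thesis .
  qed
  moreover have "\<bar>\<alpha> * \<phi>\<bar> \<le> \<alpha> * \<Phi>"
    using \<alpha> \<phi> by (simp add: abs_mult mult_left_mono)
  ultimately have "\<bar>(z + N + \<alpha> * (d * (F - (z + N)) + \<epsilon> + \<phi>)) - ((1 - \<alpha> * \<sigma>) * N + \<alpha> * \<epsilon>)\<bar>
      \<le> (1 - \<alpha> * d) * b + \<alpha> * d * (\<gamma> * (b + n)) + \<alpha> * d * n + \<alpha> * \<Phi>"
    by linarith
  also have "\<dots> = b - \<alpha> * d * ((1 - \<gamma>) * b - (1 + \<gamma>) * n) + \<alpha> * \<Phi>"
    by (simp add: algebra_simps)
  \<comment> \<open>The bracket is nonnegative by \<open>drift\<close>, which permits lowering the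
    unknown \<open>d\<close> to \<open>\<sigma>\<close>.\<close>
  also have "\<dots> \<le> b - \<alpha> * \<sigma> * ((1 - \<gamma>) * b - (1 + \<gamma>) * n) + \<alpha> * \<Phi>"
    using d \<alpha> drift by (intro add_right_mono diff_left_mono mult_right_mono mult_left_mono) auto
  finally show ?thesis .
qed

text \<open>Follows from \<open>x \<le> sqrt x\<close> at \<open>x = u / (u + 1)\<close>. The mean
  value theorem would give half of the right-hand side, but this form is what
  \<open>envelope_step\<close> can absorb.\<close>

lemma inverse_sqrt_diff_le:
  fixes u :: real
  assumes "0 < u"
  shows "1 / sqrt u - 1 / sqrt (u + 1) \<le> 1 / (u * sqrt u)"
proof -
  have "u / (u + 1) \<le> sqrt (u / (u + 1))"
    using assms by (intro real_le_rsqrt) (unfold power2_eq_square, rule mult_left_le, simp_all)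
  moreover have "1 - 1 / u \<le> u / (u + 1)"
    using assms by (simp add: field_simps)
  ultimately have "1 - 1 / u \<le> sqrt u / sqrt (u + 1)"
    by (simp add: real_sqrt_divide)
  then have "1 / sqrt u * (1 - 1 / u) \<le> 1 / sqrt u * (sqrt u / sqrt (u + 1))"
    using assms by (intro mult_left_mono) auto
  then show ?thesis using assms by (simp add: right_diff_distrib mult.commute)
qed

text \<open>Write \<open>g = 1 - \<gamma>\<close>. The choice \<open>g A = 4 m\<close> makes the
  noise loss \<open>(1 + \<gamma>) m\<close> at most half of \<open>g A\<close>, and since
  \<open>h \<sigma> g \<ge> 2\<close> the other half covers the decay of \<open>A / sqrt u\<close>.
  In the second term the condition on \<open>B\<close> lets half of the contraction absorb the lag
  \<open>\<Phi>\<close>, and the rest covers the decay of \<open>B / u\<close>. The first conclusion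
  supplies the hypothesis \<open>drift\<close> of \<open>error_step\<close>.\<close>

lemma envelope_step:
  fixes A B h \<sigma> \<gamma> m \<Phi> u :: real
  assumes u: "0 < u" and \<gamma>: "0 \<le> \<gamma>" "\<gamma> < 1" and \<sigma>: "0 < \<sigma>" and h: "2 / (\<sigma> * (1 - \<gamma>)) \<le> h"
    and m: "0 \<le> m" and A: "A = 4 * m / (1 - \<gamma>)" and B: "2 * \<Phi> / (\<sigma> * (1 - \<gamma>)) \<le> B" and \<Phi>: "0 \<le> \<Phi>"
  defines "b \<equiv> \<lambda>u. A / sqrt u + B / u" and "n \<equiv> m / sqrt u"
  shows "0 \<le> (1 - \<gamma>) * b u - (1 + \<gamma>) * n"
    and "b u - h / u * \<sigma> * ((1 - \<gamma>) * b u - (1 + \<gamma>) * n) + h / u * (\<Phi> / u) \<le> b (u + 1)"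
proof -
  define g where "g = 1 - \<gamma>"
  have g: "0 < g" using \<gamma> by (simp add: g_def)
  have A0: "0 \<le> A" using m g by (simp add: A g_def)
  have "0 \<le> 2 * \<Phi> / (\<sigma> * (1 - \<gamma>))" using \<Phi> \<sigma> g by (simp add: g_def)
  then have B0: "0 \<le> B" using B by linarith
  have hsg: "2 \<le> h * \<sigma> * g" using h \<sigma> g by (simp add: g_def field_simps)
  have h0: "0 < h" using hsg \<sigma> g by (smt (verit) mult_nonneg_nonneg mult_nonpos_nonneg)
  have gA: "g * A = 4 * m" using g by (simp add: A g_def)
  have su: "0 < sqrt u" using u by simp
  define D where "D = (1 - \<gamma>) * b u - (1 + \<gamma>) * n"
  have "D = (g * A - (1 + \<gamma>) * m) / sqrt u + g * B / u"
    using u by (simp add: D_def b_def n_def g_def field_simps)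
  moreover have "(g * A / 2) / sqrt u \<le> (g * A - (1 + \<gamma>) * m) / sqrt u"
  proof (rule divide_right_mono)
    have "(1 + \<gamma>) * m \<le> 2 * m" using \<gamma> m by (intro mult_right_mono) auto
    then show "g * A / 2 \<le> g * A - (1 + \<gamma>) * m" unfolding gA by linarith
  qed (use su in simp)
  ultimately have D: "g * (A / (2 * sqrt u) + B / u) \<le> D"
    by (simp add: algebra_simps)
  have "0 \<le> g * (A / (2 * sqrt u) + B / u)" using g A0 B0 u by simp
  then show "0 \<le> (1 - \<gamma>) * b u - (1 + \<gamma>) * n" using D by (simp add: D_def)
  have "h / u * \<sigma> * D \<ge> h / u * \<sigma> * (g * (A / (2 * sqrt u) + B / u))"
    using h0 u \<sigma> by (intro mult_left_mono D) auto
  moreover have "h / u * \<sigma> * (g * (A / (2 * sqrt u) + B / u)) = (h * \<sigma> * g) * (A / (2 * (u * sqrt u))) + h * \<sigma> * g * B / u\<^sup>2"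
    using u by (simp add: field_simps power2_eq_square)
  moreover have "(h * \<sigma> * g) * (A / (2 * (u * sqrt u))) \<ge> 2 * (A / (2 * (u * sqrt u)))"
    using hsg A0 u by (intro mult_right_mono) auto
  moreover have "h * \<sigma> * g * B / u\<^sup>2 - h * \<Phi> / u\<^sup>2 \<ge> B / u\<^sup>2"
  proof -
    have "\<Phi> \<le> B * \<sigma> * g / 2" using B \<sigma> g by (simp add: g_def field_simps)
    then have "h * \<Phi> \<le> h * (B * \<sigma> * g / 2)" using h0 by (intro mult_left_mono) auto
    moreover have "2 * B \<le> h * \<sigma> * g * B" using hsg B0 by (rule mult_right_mono)
    ultimately have "B \<le> h * \<sigma> * g * B - h * \<Phi>" by (simp add: algebra_simps)
    then have "B / u\<^sup>2 \<le> (h * \<sigma> * g * B - h * \<Phi>) / u\<^sup>2" by (rule divide_right_mono) simp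
    then show ?thesis by (simp add: diff_divide_distrib)
  qed
  moreover have "A / sqrt u - A / sqrt (u + 1) \<le> A / (u * sqrt u)"
    using mult_left_mono[OF inverse_sqrt_diff_le[OF u] A0] by (simp add: right_diff_distrib)
  moreover have "B / u - B / (u + 1) \<le> B / u\<^sup>2"
  proof -
    have "1 / u - 1 / (u + 1) = 1 / (u * (u + 1))" using u by (simp add: field_simps)
    also have "\<dots> \<le> 1 / u\<^sup>2" using u by (intro divide_left_mono) (auto simp: power2_eq_square)
    finally have "1 / u - 1 / (u + 1) \<le> 1 / u\<^sup>2" .
    from mult_left_mono[OF this B0] show ?thesis by (simp add: right_diff_distrib)
  qed
  ultimately show "b u - h / u * \<sigma> * ((1 - \<gamma>) * b u - (1 + \<gamma>) * n) + h / u * (\<Phi> / u) \<le> b (u + 1)"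
    unfolding D_def[symmetric] by (simp add: b_def power2_eq_square)
qed


section \<open>Q-learning\<close>

definition state_value :: "real ^ ('s::finite \<times> 'a::finite) \<Rightarrow> 's \<Rightarrow> real" where
  "state_value Q s = (MAX a. Q $ (s, a))"

lemma abs_state_value_le: "(\<And>x. \<bar>Q $ x\<bar> \<le> c) \<Longrightarrow> \<bar>state_value Q s\<bar> \<le> c"
  using abs_Max_diff_le[of "\<lambda>a. Q $ (s, a)" "\<lambda>_. 0" c] by (simp add: state_value_def)

lemma q_iter_Suc_nth:
  "q_iter \<gamma> \<alpha> \<omega> (Suc t) $ i = (if fst (\<omega> t) = i
     then (1 - \<alpha> t) * q_iter \<gamma> \<alpha> \<omega> t $ i
       + \<alpha> t * (snd (\<omega> t) + \<gamma> * state_value (q_iter \<gamma> \<alpha> \<omega> t) (fst (fst (\<omega> (Suc t)))))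
     else q_iter \<gamma> \<alpha> \<omega> t $ i)"
  by (auto simp: Let_def state_value_def split: prod.splits)

declare q_iter.simps(2) [simp del]

text \<open>Expands evaluation at the random next state into finitely many indicators, which the
  measurability prover can handle.\<close>

lemma state_value_sum: "state_value Q (fst (fst z)) = (\<Sum>s\<in>UNIV. if fst (fst z) = s then state_value Q s else 0)"
  by simp

lemma measurable_q_iter [measurable]:
  fixes i :: "'s::finite \<times> 'a::finite"
  shows "(\<lambda>\<omega>. q_iter \<gamma> \<alpha> \<omega> t $ i) \<in> borel_measurable path_space"
proof (induction t arbitrary: i)
  case (Suc t)
  note [measurable] = Suc
  have [measurable]: "(\<lambda>\<omega> :: nat \<Rightarrow> ('s \<times> 'a) \<times> real. state_value (q_iter \<gamma> \<alpha> \<omega> t) s) \<in> borel_measurable path_space" for s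
    unfolding state_value_def by (rule borel_measurable_Max) (simp_all add: Suc)
  have [measurable]: "Measurable.pred path_space (\<lambda>\<omega> :: nat \<Rightarrow> ('s \<times> 'a) \<times> real. fst (fst (\<omega> (Suc t))) = s)" for s
    by (rule measurable_compose[OF measurable_path_state]) simp
  show ?case
    unfolding q_iter_Suc_nth state_value_sum by measurable
qed simp

text \<open>The iterate at time \<open>t\<close> has already seen the state of step
  \<open>t\<close>, in the target of step \<open>t - 1\<close>, but not the reward of step
  \<open>t\<close>. This is why the iterate counts as depending on \<open>t + 1\<close>
  coordinates.\<close>

lemma q_iter_depends:
  assumes "\<And>k. k < t \<Longrightarrow> \<omega> k = \<omega>' k" and "fst (\<omega> t) = fst (\<omega>' t)"
  shows "q_iter \<gamma> \<alpha> \<omega> t = q_iter \<gamma> \<alpha> \<omega>' t"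
  using assms
proof (induction t)
  case (Suc t)
  then have eq: "q_iter \<gamma> \<alpha> \<omega> t = q_iter \<gamma> \<alpha> \<omega>' t" "\<omega> t = \<omega>' t" by simp_all
  show ?case
    unfolding vec_eq_iff q_iter_Suc_nth using Suc.prems(2) eq by simp
qed simp

lemma bellman_state_value: "bellman P r \<gamma> Q x = r x + \<gamma> * pmf_mean (P x) (state_value Q)"
  by (simp add: bellman_def state_value_def[abs_def])

text \<open>\<open>hit\<close> is all that remains of mixing and stationarity, and the fixed-point
  equation for \<open>Qs\<close> all that remains of optimality.\<close>

locale q_learning = bounded_mdp P R \<gamma> b
  for P :: "'s::finite \<times> 'a::finite \<Rightarrow> 's pmf" and R :: "'s \<times> 'a \<Rightarrow> real measure" and \<gamma> b :: real +
  fixes \<pi> :: "'s \<Rightarrow> 'a pmf" and \<iota> :: "'s pmf" and \<sigma> h t\<^sub>0 :: real and \<tau> :: nat and Qs :: "real ^ ('s \<times> 'a)"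
  assumes hit: "\<And>x i. \<sigma> \<le> pmf (nstep (sa_kernel P \<pi>) \<tau> x) i"
    and \<sigma>_pos: "0 < \<sigma>" and \<tau>_pos: "1 \<le> \<tau>"
    and t0_h: "4 * h \<le> t\<^sub>0" and t0_\<tau>: "\<tau> \<le> t\<^sub>0"
    and h_ge: "2 / (\<sigma> * (1 - \<gamma>)) \<le> h"
    and Qs: "\<And>x. bellman P (reward_mean R) \<gamma> Qs x = Qs $ x"
begin

sublocale reward_chain R "sa_kernel P \<pi>" "with_action \<pi> \<iota>"
  by (rule reward_chain.intro) (rule R_prob R_sets)+

abbreviation "r \<equiv> reward_mean R"
abbreviation "F \<equiv> bellman P (reward_mean R) \<gamma>"

definition \<alpha> :: "nat \<Rightarrow> real" where "\<alpha> t = h / (t + t\<^sub>0)"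
text \<open>The largest possible discounted return, and the solution of
  \<open>b + \<gamma> X = X\<close>; it bounds \<open>Qs\<close>, every iterate and every
  target.\<close>

definition X :: real where "X = b / (1 - \<gamma>)"

lemma \<sigma>_le: "\<sigma> \<le> 1"
  using hit[of undefined undefined] pmf_le_1 by (meson order_trans)

lemma h_pos: "0 < h"
proof -
  have "0 < 2 / (\<sigma> * (1 - \<gamma>))" using \<sigma>_pos \<gamma>_less by simp
  then show ?thesis using h_ge by linarith
qed

lemma h_\<sigma>: "2 \<le> h * \<sigma>"
proof -
  have "2 \<le> h * (\<sigma> * (1 - \<gamma>))" using h_ge \<sigma>_pos \<gamma>_less by (simp add: pos_divide_le_eq)
  also have "\<dots> \<le> h * (\<sigma> * 1)"
    using h_pos \<sigma>_pos \<gamma>_nonneg by (intro mult_left_mono) auto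
  finally show ?thesis by simp
qed

lemma t0_pos: "0 < t\<^sub>0" using t0_h h_pos by linarith

lemma \<alpha>_nonneg: "0 \<le> \<alpha> t" using h_pos t0_pos by (simp add: \<alpha>_def)

lemma \<alpha>_le: "\<alpha> t \<le> 1"
  using h_pos t0_h by (simp add: \<alpha>_def pos_divide_le_eq)

lemma X_nonneg: "0 \<le> X" using b_nonneg \<gamma>_less by (simp add: X_def)

lemma X_fixed: "b + \<gamma> * X = X"
  using \<gamma>_less by (simp add: X_def field_simps)

lemma F_bound: "(\<And>x. \<bar>Q $ x\<bar> \<le> c) \<Longrightarrow> \<bar>F Q x\<bar> \<le> b + \<gamma> * c"
proof -
  assume "\<And>x. \<bar>Q $ x\<bar> \<le> c"
  then have "\<bar>pmf_mean (P x) (state_value Q)\<bar> \<le> c"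
    by (intro pmf_mean_abs_le abs_state_value_le)
  then have "\<bar>\<gamma> * pmf_mean (P x) (state_value Q)\<bar> \<le> \<gamma> * c"
    using \<gamma>_nonneg by (simp add: abs_mult mult_left_mono)
  then show ?thesis
    unfolding bellman_state_value using abs_reward_mean[of x] by linarith
qed

lemma Qs_bound: "\<bar>Qs $ x\<bar> \<le> X"
proof -
  define m where "m = (MAX x. \<bar>Qs $ x\<bar>)"
  have le: "\<bar>Qs $ x\<bar> \<le> m" for x unfolding m_def by (intro Max_ge) auto
  have "m \<in> range (\<lambda>x. \<bar>Qs $ x\<bar>)" unfolding m_def by (intro Max_in) auto
  then obtain y where "m = \<bar>Qs $ y\<bar>" by blast
  then have "m \<le> b + \<gamma> * m" using F_bound[of Qs m y, OF le] by (simp add: Qs)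
  then have "m * (1 - \<gamma>) \<le> b" by (simp add: algebra_simps)
  then have "m \<le> X" using \<gamma>_less by (simp add: X_def pos_le_divide_eq)
  then show ?thesis using le[of x] by linarith
qed

text \<open>Rewards are bounded by \<open>b\<close> only almost surely; clipping them makes all bounds below hold
  everywhere without changing their law.\<close>

definition clipped :: "(nat \<Rightarrow> ('s \<times> 'a) \<times> real) \<Rightarrow> nat \<Rightarrow> ('s \<times> 'a) \<times> real" where
  "clipped \<omega> t = (fst (\<omega> t), clip b (snd (\<omega> t)))"

definition Q :: "nat \<Rightarrow> (nat \<Rightarrow> ('s \<times> 'a) \<times> real) \<Rightarrow> real ^ ('s \<times> 'a)" where
  "Q t \<omega> = q_iter \<gamma> \<alpha> (clipped \<omega>) t"

definition target :: "nat \<Rightarrow> (nat \<Rightarrow> ('s \<times> 'a) \<times> real) \<Rightarrow> real" where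
  "target t \<omega> = clip b (snd (\<omega> t)) + \<gamma> * state_value (Q t \<omega>) (fst (fst (\<omega> (Suc t))))"

definition visit :: "'s \<times> 'a \<Rightarrow> nat \<Rightarrow> (nat \<Rightarrow> ('s \<times> 'a) \<times> real) \<Rightarrow> real" where
  "visit i t \<omega> = (if fst (\<omega> t) = i then 1 else 0)"

lemma Q_0 [simp]: "Q 0 \<omega> = 0"
  by (simp add: Q_def)

lemma Q_Suc: "Q (Suc t) \<omega> $ i = Q t \<omega> $ i + \<alpha> t * (visit i t \<omega> * (target t \<omega> - Q t \<omega> $ i))"
  by (simp add: Q_def target_def visit_def q_iter_Suc_nth clipped_def algebra_simps)

lemma measurable_clipped: "clipped \<in> path_space \<rightarrow>\<^sub>M path_space"
proof (rule measurable_PiM_single')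
  show "(\<lambda>\<omega>. clipped \<omega> t) \<in> path_space \<rightarrow>\<^sub>M step_space" for t
    unfolding clipped_def by measurable
qed (auto simp: space_pair_measure)

lemma measurable_Q [measurable]: "(\<lambda>\<omega>. Q t \<omega> $ i) \<in> borel_measurable path_space"
  unfolding Q_def by (rule measurable_compose[OF measurable_clipped measurable_q_iter])

lemma depends_Q: "depends_before (Suc t) (Q t)"
  unfolding depends_before_def Q_def by (auto intro!: q_iter_depends simp: clipped_def)

lemma measurable_state_value_Q [measurable]: "(\<lambda>\<omega>. state_value (Q t \<omega>) s) \<in> borel_measurable path_space"
  unfolding state_value_def by (rule borel_measurable_Max) simp_all

lemma measurable_F_Q [measurable]: "(\<lambda>\<omega>. F (Q t \<omega>) i) \<in> borel_measurable path_space"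
  unfolding bellman_state_value pmf_mean_sum by measurable

lemma measurable_visit [measurable]: "visit i t \<in> borel_measurable path_space"
  unfolding visit_def[abs_def] by (rule measurable_of_state)

lemma measurable_target [measurable]: "target t \<in> borel_measurable path_space"
proof -
  have [measurable]: "Measurable.pred path_space (\<lambda>\<omega>. fst (fst (\<omega> (Suc t))) = s)" for s :: 's
    by (rule measurable_compose[OF measurable_path_state]) simp
  show ?thesis
    unfolding target_def[abs_def] state_value_sum by measurable
qed

lemma visit_bounds: "0 \<le> visit i t \<omega>" "visit i t \<omega> \<le> 1"
  by (auto simp: visit_def)

lemma abs_target_le:
  assumes "\<And>i. \<bar>Q t \<omega> $ i\<bar> \<le> X"
  shows "\<bar>target t \<omega>\<bar> \<le> X"
proof -
  have "\<bar>\<gamma> * state_value (Q t \<omega>) s\<bar> \<le> \<gamma> * X" for s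
    using \<gamma>_nonneg abs_state_value_le[OF assms] by (simp add: abs_mult mult_left_mono)
  then have "\<bar>target t \<omega>\<bar> \<le> b + \<gamma> * X"
    unfolding target_def using clip_bound[OF b_nonneg, of "snd (\<omega> t)"] by (intro abs_triangle_ineq[THEN order_trans] add_mono)
  then show ?thesis by (simp add: X_fixed)
qed

lemma Q_bound: "\<bar>Q t \<omega> $ i\<bar> \<le> X"
proof (induction t arbitrary: i)
  case (Suc t)
  define a where "a = \<alpha> t * visit i t \<omega>"
  have a: "0 \<le> a" "a \<le> 1"
    using \<alpha>_nonneg[of t] \<alpha>_le[of t] visit_bounds[of i t \<omega>] by (auto simp: a_def intro: mult_le_one)
  have "Q (Suc t) \<omega> $ i = (1 - a) * Q t \<omega> $ i + a * target t \<omega>"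
    by (simp add: Q_Suc a_def algebra_simps)
  also have "\<bar>\<dots>\<bar> \<le> \<bar>(1 - a) * Q t \<omega> $ i\<bar> + \<bar>a * target t \<omega>\<bar>" by (rule abs_triangle_ineq)
  also have "\<dots> \<le> (1 - a) * X + a * X"
    using a Suc[of i] abs_target_le[OF Suc] by (intro add_mono) (simp_all add: abs_mult mult_left_mono)
  finally show ?case by (simp add: algebra_simps)
qed (simp add: X_nonneg)

lemma target_bound: "\<bar>target t \<omega>\<bar> \<le> X"
  by (rule abs_target_le[OF Q_bound])

lemma F_Q_bound: "\<bar>F (Q t \<omega>) i\<bar> \<le> X"
  using F_bound[of "Q t \<omega>" X i, OF Q_bound] X_fixed by simp

lemma Q_step: "\<bar>Q (Suc t) \<omega> $ i - Q t \<omega> $ i\<bar> \<le> \<alpha> t * (2 * X)"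
proof -
  have "\<bar>target t \<omega> - Q t \<omega> $ i\<bar> \<le> 2 * X"
    using target_bound[of t \<omega>] Q_bound[of t \<omega> i] by linarith
  then have "\<bar>visit i t \<omega> * (target t \<omega> - Q t \<omega> $ i)\<bar> \<le> 2 * X"
    using X_nonneg by (simp add: visit_def)
  then show ?thesis
    using \<alpha>_nonneg[of t] by (simp add: Q_Suc abs_mult[of "\<alpha> t"] mult_left_mono)
qed

lemma \<alpha>_antimono: "s \<le> t \<Longrightarrow> \<alpha> t \<le> \<alpha> s"
  using h_pos t0_pos by (auto simp: \<alpha>_def intro!: divide_left_mono)

lemma Q_drift_aux: "\<bar>Q (s + n) \<omega> $ i - Q s \<omega> $ i\<bar> \<le> n * (\<alpha> s * (2 * X))"
proof (induction n)
  case (Suc n)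
  have "\<alpha> (s + n) * (2 * X) \<le> \<alpha> s * (2 * X)"
    using X_nonneg \<alpha>_antimono[of s "s + n"] by (intro mult_right_mono) auto
  then have "\<bar>Q (Suc (s + n)) \<omega> $ i - Q (s + n) \<omega> $ i\<bar> \<le> \<alpha> s * (2 * X)"
    using Q_step[of "s + n" \<omega> i] by linarith
  then show ?case using Suc by (simp add: algebra_simps)
qed simp

lemma Q_drift:
  assumes "\<tau> \<le> t"
  shows "\<bar>Q t \<omega> $ i - Q (t - \<tau>) \<omega> $ i\<bar> \<le> 4 * X * \<tau> * \<alpha> t"
proof -
  \<comment> \<open>Both \<open>t\<close> and \<open>t\<^sub>0\<close> are at least
    \<open>\<tau>\<close>, so the step size at most halves during the lag.\<close>
  have "t + t\<^sub>0 \<le> 2 * (real (t - \<tau>) + t\<^sub>0)" using assms t0_\<tau> by (simp add: of_nat_diff)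
  moreover have "0 < real (t - \<tau>) + t\<^sub>0" "0 < t + t\<^sub>0" using t0_pos by auto
  ultimately have "\<alpha> (t - \<tau>) \<le> 2 * \<alpha> t"
    using h_pos by (simp add: \<alpha>_def divide_simps)
  then have "\<tau> * (\<alpha> (t - \<tau>) * (2 * X)) \<le> \<tau> * (2 * \<alpha> t * (2 * X))"
    using X_nonneg by (intro mult_left_mono mult_right_mono) auto
  then show ?thesis
    using Q_drift_aux[of "t - \<tau>" \<tau> \<omega> i] assms by (simp add: mult_ac)
qed

section \<open>Drift, noise and lag\<close>

definition H :: "'s \<times> 'a \<Rightarrow> nat \<Rightarrow> (nat \<Rightarrow> ('s \<times> 'a) \<times> real) \<Rightarrow> real" where
  "H i t \<omega> = F (Q t \<omega>) i - Q t \<omega> $ i"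

definition hit_prob :: "'s \<times> 'a \<Rightarrow> nat \<Rightarrow> (nat \<Rightarrow> ('s \<times> 'a) \<times> real) \<Rightarrow> real" where
  "hit_prob i s \<omega> = pmf (nstep (sa_kernel P \<pi>) \<tau> (fst (\<omega> s))) i"

text \<open>Two deviations: of the visit from its probability given the state at time
  \<open>t - \<tau>\<close>, multiplied by the Bellman residual frozen at that time, and of the
  target from its mean at a visited \<open>i\<close>. Before time \<open>\<tau>\<close> there is no
  state to look back to, and the noise is set to 0.\<close>

definition noise :: "'s \<times> 'a \<Rightarrow> nat \<Rightarrow> (nat \<Rightarrow> ('s \<times> 'a) \<times> real) \<Rightarrow> real" where
  "noise i t \<omega> = (if t < \<tau> then 0
     else (visit i t \<omega> - hit_prob i (t - \<tau>) \<omega>) * H i (t - \<tau>) \<omega> + visit i t \<omega> * (target t \<omega> - F (Q t \<omega>) i))"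

definition lag :: "'s \<times> 'a \<Rightarrow> nat \<Rightarrow> (nat \<Rightarrow> ('s \<times> 'a) \<times> real) \<Rightarrow> real" where
  "lag i t \<omega> = (visit i t \<omega> - hit_prob i (t - \<tau>) \<omega>) * (H i t \<omega> - H i (t - \<tau>) \<omega>)"

lemma hit_prob_bounds: "\<sigma> \<le> hit_prob i s \<omega>" "hit_prob i s \<omega> \<le> 1" "0 \<le> hit_prob i s \<omega>"
  using hit by (auto simp: hit_prob_def pmf_le_1)

lemma H_bound: "\<bar>H i t \<omega>\<bar> \<le> 2 * X"
  using F_Q_bound[of t \<omega> i] Q_bound[of t \<omega> i] by (simp add: H_def)

lemma noise_bound: "\<bar>noise i t \<omega>\<bar> \<le> 4 * X"
proof (cases "t < \<tau>")
  case False
  have "\<bar>visit i t \<omega> - hit_prob i (t - \<tau>) \<omega>\<bar> \<le> 1"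
    using visit_bounds[of i t \<omega>] hit_prob_bounds[of i "t - \<tau>" \<omega>] by linarith
  then have "\<bar>visit i t \<omega> - hit_prob i (t - \<tau>) \<omega>\<bar> * \<bar>H i (t - \<tau>) \<omega>\<bar> \<le> 1 * (2 * X)"
    using H_bound[of i "t - \<tau>" \<omega>] X_nonneg by (intro mult_mono) auto
  moreover have "\<bar>target t \<omega> - F (Q t \<omega>) i\<bar> \<le> 2 * X"
    using target_bound[of t \<omega>] F_Q_bound[of t \<omega> i] by linarith
  then have "\<bar>visit i t \<omega> * (target t \<omega> - F (Q t \<omega>) i)\<bar> \<le> 2 * X"
    using X_nonneg by (simp add: visit_def)
  ultimately show ?thesis
    using False by (simp add: noise_def abs_mult[symmetric])
qed (simp add: noise_def X_nonneg)

lemma lag_bound: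
  assumes "\<tau> \<le> t"
  shows "\<bar>lag i t \<omega>\<bar> \<le> 8 * X * \<tau> * h / (t + t\<^sub>0)"
proof -
  let ?D = "4 * X * \<tau> * \<alpha> t"
  have D: "0 \<le> ?D" using X_nonneg \<alpha>_nonneg by simp
  have "\<bar>F (Q t \<omega>) i - F (Q (t - \<tau>) \<omega>) i\<bar> \<le> \<gamma> * ?D"
    by (intro abs_bellman_diff_le \<gamma>_nonneg Q_drift assms)
  also have "\<dots> \<le> 1 * ?D" using \<gamma>_less D by (intro mult_right_mono) auto
  finally have "\<bar>H i t \<omega> - H i (t - \<tau>) \<omega>\<bar> \<le> 2 * ?D"
    using Q_drift[OF assms, of \<omega> i] unfolding H_def by linarith
  moreover have "\<bar>visit i t \<omega> - hit_prob i (t - \<tau>) \<omega>\<bar> \<le> 1"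
    using visit_bounds[of i t \<omega>] hit_prob_bounds[of i "t - \<tau>" \<omega>] by linarith
  ultimately have "\<bar>lag i t \<omega>\<bar> \<le> 1 * (2 * ?D)"
    unfolding lag_def abs_mult by (intro mult_mono) auto
  then show ?thesis by (simp add: \<alpha>_def)
qed

text \<open>In the drift the old hitting probability multiplies the current residual, so that the
  contraction acts on the current error. Only the factor \<open>visit - hit_prob\<close> meets a
  delayed residual, and \<open>lag\<close> is the price of that replacement.\<close>

lemma Q_Suc_decomposed:
  assumes "\<tau> \<le> t"
  shows "Q (Suc t) \<omega> $ i = Q t \<omega> $ i + \<alpha> t * (hit_prob i (t - \<tau>) \<omega> * H i t \<omega> + noise i t \<omega> + lag i t \<omega>)"
  using assms by (simp add: Q_Suc noise_def lag_def H_def algebra_simps)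

lemma measurable_hit_prob [measurable]: "hit_prob i t \<in> borel_measurable path_space"
  unfolding hit_prob_def[abs_def] by (rule measurable_of_state)

lemma measurable_H [measurable]: "H i t \<in> borel_measurable path_space"
  unfolding H_def[abs_def] by measurable

lemma measurable_noise [measurable]: "noise i t \<in> borel_measurable path_space"
  unfolding noise_def[abs_def] by measurable

lemma depends_noise: "depends_before (t + 2) (noise i t)"
  unfolding depends_before_def
proof (intro allI impI)
  fix \<omega> \<omega>' :: "nat \<Rightarrow> ('s \<times> 'a) \<times> real"
  assume *: "\<forall>k<t + 2. \<omega> k = \<omega>' k"
  then have "Q t \<omega> = Q t \<omega>'" "Q (t - \<tau>) \<omega> = Q (t - \<tau>) \<omega>'"
    by (auto intro!: depends_beforeD[OF depends_Q])
  then show "noise i t \<omega> = noise i t \<omega>'"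
    using * by (simp add: noise_def visit_def hit_prob_def H_def target_def)
qed

lemma depends_H: "depends_before (Suc t) (H i t)"
  unfolding H_def[abs_def] by (rule depends_before_comp[OF depends_Q])

text \<open>The noise is a sum of three centred pieces: the visit, by the Markov property over
  \<open>\<tau>\<close> steps; the reward, drawn independently of the past given the pair; and the
  transition, by the Markov property over one step. A test function of the history up to
  \<open>t - \<tau>\<close> is admissible for all three.\<close>

lemma noise_orthogonal:
  assumes t: "\<tau> \<le> t" and g [measurable]: "g \<in> borel_measurable path_space"
    and dep: "depends_before (Suc (t - \<tau>)) g" and bg: "\<And>\<omega>. \<bar>g \<omega>\<bar> \<le> B"
  shows "(\<integral>\<omega>. g \<omega> * noise i t \<omega> \<partial>M) = 0"
proof -
  have B: "0 \<le> B" using bg[of undefined] by linarith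
  have int: "integrable M (\<lambda>\<omega>. g \<omega> * f \<omega>)"
    if "f \<in> borel_measurable path_space" "\<And>\<omega>. \<bar>f \<omega>\<bar> \<le> C" for f C
    by (rule integrable_bounded[where c = "B * C"])
       (use that B in \<open>simp_all add: abs_mult mult_mono bg\<close>)
  \<comment> \<open>Here \<open>\<tau> \<ge> 1\<close> matters: the reward of step \<open>t\<close>
    must be new to the test function.\<close>
  have dep_t: "depends_before t g"
    using t \<tau>_pos by (intro depends_before_mono[OF dep]) simp

  have visits: "(\<integral>\<omega>. g \<omega> * ((visit i t \<omega> - hit_prob i (t - \<tau>) \<omega>) * H i (t - \<tau>) \<omega>) \<partial>M) = 0"
  proof -
    let ?G = "\<lambda>\<omega>. g \<omega> * H i (t - \<tau>) \<omega>" and ?u = "\<lambda>x. if x = i then 1 else 0 :: real"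
    have bG: "\<bar>?G \<omega>\<bar> \<le> B * (2 * X)" for \<omega>
      unfolding abs_mult using B by (intro mult_mono bg H_bound) auto
    have u: "pmf_mean q ?u = pmf q i" for q
      by (simp add: pmf_mean_sum if_distrib cong: if_cong)
    have "(\<integral>\<omega>. ?G \<omega> * ?u (fst (\<omega> (t - \<tau> + \<tau>))) \<partial>M) = (\<integral>\<omega>. ?G \<omega> * pmf_mean (nstep (sa_kernel P \<pi>) \<tau> (fst (\<omega> (t - \<tau>)))) ?u \<partial>M)"
      by (rule integral_nstep_state[OF _ depends_before_comp2[where h = "(*)", OF dep depends_H] bG]) measurable
    then have eq: "(\<integral>\<omega>. ?G \<omega> * visit i t \<omega> \<partial>M) = (\<integral>\<omega>. ?G \<omega> * hit_prob i (t - \<tau>) \<omega> \<partial>M)"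
      using t by (simp add: u visit_def hit_prob_def)
    have i1: "integrable M (\<lambda>\<omega>. ?G \<omega> * visit i t \<omega>)"
      by (rule integrable_bounded[where c = "B * (2 * X) * 1"])
         (measurable, unfold abs_mult[of "?G _"], intro mult_mono bG, use visit_bounds B X_nonneg in auto)
    have i2: "integrable M (\<lambda>\<omega>. ?G \<omega> * hit_prob i (t - \<tau>) \<omega>)"
      by (rule integrable_bounded[where c = "B * (2 * X) * 1"])
         (measurable, unfold abs_mult[of "?G _"], intro mult_mono bG, use hit_prob_bounds B X_nonneg in auto)
    have "(\<lambda>\<omega>. g \<omega> * ((visit i t \<omega> - hit_prob i (t - \<tau>) \<omega>) * H i (t - \<tau>) \<omega>))
        = (\<lambda>\<omega>. ?G \<omega> * visit i t \<omega> - ?G \<omega> * hit_prob i (t - \<tau>) \<omega>)"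
      by (simp add: algebra_simps)
    then show ?thesis using i1 i2 eq by simp
  qed

  \<comment> \<open>At a visit to \<open>i\<close>, the deviation of the target is this reward
    deviation plus \<open>\<gamma>\<close> times the transition deviation treated afterwards.
    Clipping preserves the mean \<open>r i\<close>, as it alters \<open>R i\<close> only on a null
    set.\<close>
  let ?f = "\<lambda>y. (if fst y = i then 1 else 0) * (clip b (snd y) - r i)"
  have f_bound: "\<bar>?f y\<bar> \<le> 2 * b" for y
    using clip_bound[OF b_nonneg, of "snd y"] abs_reward_mean[of i] b_nonneg by auto
  have f_meas: "?f \<in> borel_measurable (step_space :: (('s \<times> 'a) \<times> real) measure)"
  proof -
    have [measurable]: "(\<lambda>y. if fst y = i then 1 else 0 :: real) \<in> borel_measurable (step_space :: (('s \<times> 'a) \<times> real) measure)"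
      by (rule measurable_compose[OF measurable_fst]) simp
    show ?thesis by measurable
  qed
  have rewards: "(\<integral>\<omega>. g \<omega> * ?f (\<omega> t) \<partial>M) = 0"
  proof -
    have zero: "(\<integral>z. ?f (x, z) \<partial>R x) = 0" for x
    proof (cases "x = i")
      case True
      interpret prob_space "R i" by (rule R_prob)
      have "integrable (R i) (clip b)"
        by (rule integrable_const_bound[of _ b]) (use clip_bound[OF b_nonneg] in \<open>auto simp: measurable_cong_sets[OF R_sets refl]\<close>)
      then show ?thesis using True by (simp add: integral_clip_reward[OF R_bounded] prob_space)
    qed simp
    have "(\<integral>y. ?f y \<partial>step_law R (sa_kernel P \<pi>) (with_action \<pi> \<iota>) t \<omega>) = 0" for \<omega>
      unfolding step_law_def by (subst integral_with_reward[OF f_meas f_bound]) (simp only: zero, simp)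
    then show ?thesis
      using integral_step[OF g dep_t f_meas bg f_bound] by simp
  qed

  \<comment> \<open>The next state is split into its values \<open>s\<close>: the coefficient
    \<open>state_value (Q t \<omega>) s\<close> is known at time \<open>t\<close>, and only an
    indicator has to be averaged over the transition.\<close>
  have transitions: "(\<integral>\<omega>. g \<omega> * (visit i t \<omega> * (state_value (Q t \<omega>) (fst (fst (\<omega> (Suc t)))) - pmf_mean (P i) (state_value (Q t \<omega>)))) \<partial>M) = 0"
  proof -
    let ?G = "\<lambda>s \<omega>. g \<omega> * (visit i t \<omega> * state_value (Q t \<omega>) s)"
    let ?u = "\<lambda>s x. if fst x = s then 1 else 0 :: real"
    have dG: "depends_before (Suc t) (?G s)" for s
    proof -
      have "depends_before (Suc t) (visit i t)"
        unfolding visit_def[abs_def] by (rule depends_before_coord[where h = "\<lambda>y. if fst y = i then 1 else 0"]) simp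
      from depends_before_comp2[OF this depends_before_comp[OF depends_Q, where h = "\<lambda>q. state_value q s"], of "(*)"]
      show ?thesis
        using depends_before_comp2[OF depends_before_mono[OF dep_t], of "Suc t" _ "(*)"] by simp
    qed
    have bG: "\<bar>?G s \<omega>\<bar> \<le> B * (1 * X)" for s \<omega>
      unfolding abs_mult using B visit_bounds by (intro mult_mono bg abs_state_value_le Q_bound) auto
    have u: "pmf_mean (sa_kernel P \<pi> x) (?u s) = pmf (P x) s" for x s
      by (simp add: pmf_mean_sa_kernel) (simp add: pmf_mean_sum if_distrib cong: if_cong)
    have G_meas [measurable]: "?G s \<in> borel_measurable path_space" for s by measurable
    have eq: "(\<integral>\<omega>. ?G s \<omega> * ?u s (fst (\<omega> (Suc t))) \<partial>M) = (\<integral>\<omega>. ?G s \<omega> * pmf (P i) s \<partial>M)" for s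
    proof -
      have "(\<integral>\<omega>. ?G s \<omega> * ?u s (fst (\<omega> (Suc t))) \<partial>M) = (\<integral>\<omega>. ?G s \<omega> * pmf_mean (sa_kernel P \<pi> (fst (\<omega> t))) (?u s) \<partial>M)"
        by (rule integral_step_state[OF G_meas dG bG])
      also have "\<dots> = (\<integral>\<omega>. ?G s \<omega> * pmf (P i) s \<partial>M)"
        by (intro Bochner_Integration.integral_cong refl) (simp only: u, simp add: visit_def)
      finally show ?thesis .
    qed
    have i1: "integrable M (\<lambda>\<omega>. ?G s \<omega> * ?u s (fst (\<omega> (Suc t))))" for s
    proof (rule integrable_bounded[where c = "B * (1 * X) * 1"])
      show "(\<lambda>\<omega>. ?G s \<omega> * ?u s (fst (\<omega> (Suc t)))) \<in> borel_measurable path_space"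
        by (rule borel_measurable_times[OF G_meas measurable_of_state])
      show "\<bar>?G s \<omega> * ?u s (fst (\<omega> (Suc t)))\<bar> \<le> B * (1 * X) * 1" for \<omega>
        unfolding abs_mult[of "?G s \<omega>"] using B X_nonneg by (intro mult_mono bG) auto
    qed
    have i2: "integrable M (\<lambda>\<omega>. ?G s \<omega> * pmf (P i) s)" for s
      using integrable_bounded[OF G_meas bG] by simp
    have "g \<omega> * (visit i t \<omega> * (state_value (Q t \<omega>) (fst (fst (\<omega> (Suc t)))) - pmf_mean (P i) (state_value (Q t \<omega>))))
        = (\<Sum>s\<in>UNIV. ?G s \<omega> * ?u s (fst (\<omega> (Suc t))) - ?G s \<omega> * pmf (P i) s)" for \<omega>
    proof -
      have "state_value (Q t \<omega>) (fst (fst (\<omega> (Suc t)))) = (\<Sum>s\<in>UNIV. state_value (Q t \<omega>) s * ?u s (fst (\<omega> (Suc t))))"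
        by (simp add: if_distrib cong: if_cong)
      then show ?thesis
        by (simp only: pmf_mean_sum sum_subtractf[symmetric] sum_distrib_left) (intro sum.cong refl, simp add: algebra_simps)
    qed
    then have "(\<integral>\<omega>. g \<omega> * (visit i t \<omega> * (state_value (Q t \<omega>) (fst (fst (\<omega> (Suc t)))) - pmf_mean (P i) (state_value (Q t \<omega>)))) \<partial>M)
        = (\<integral>\<omega>. (\<Sum>s\<in>UNIV. ?G s \<omega> * ?u s (fst (\<omega> (Suc t))) - ?G s \<omega> * pmf (P i) s) \<partial>M)"
      by (simp only:)
    also have "\<dots> = (\<Sum>s\<in>UNIV. (\<integral>\<omega>. ?G s \<omega> * ?u s (fst (\<omega> (Suc t))) \<partial>M) - (\<integral>\<omega>. ?G s \<omega> * pmf (P i) s \<partial>M))"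
      using i1 i2 by (simp only: Bochner_Integration.integral_sum Bochner_Integration.integrable_diff Bochner_Integration.integral_diff)
    also have "\<dots> = 0" unfolding eq by simp
    finally show ?thesis .
  qed

  let ?W = "\<lambda>\<omega>. visit i t \<omega> * (state_value (Q t \<omega>) (fst (fst (\<omega> (Suc t)))) - pmf_mean (P i) (state_value (Q t \<omega>)))"
  have decomposed: "g \<omega> * noise i t \<omega> = g \<omega> * ((visit i t \<omega> - hit_prob i (t - \<tau>) \<omega>) * H i (t - \<tau>) \<omega>)
      + g \<omega> * ?f (\<omega> t) + \<gamma> * (g \<omega> * ?W \<omega>)" for \<omega>
    using t by (simp add: noise_def visit_def target_def bellman_state_value algebra_simps)
  have j1: "integrable M (\<lambda>\<omega>. g \<omega> * ((visit i t \<omega> - hit_prob i (t - \<tau>) \<omega>) * H i (t - \<tau>) \<omega>))"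
  proof (rule int[of _ "1 * (2 * X)"])
    show "\<bar>(visit i t \<omega> - hit_prob i (t - \<tau>) \<omega>) * H i (t - \<tau>) \<omega>\<bar> \<le> 1 * (2 * X)" for \<omega>
      unfolding abs_mult using visit_bounds[of i t \<omega>] hit_prob_bounds[of i "t - \<tau>" \<omega>]
      by (intro mult_mono H_bound) auto
  qed measurable
  have j2: "integrable M (\<lambda>\<omega>. g \<omega> * ?f (\<omega> t))"
    by (rule int[OF measurable_compose[OF measurable_coord f_meas] f_bound])
  have j3: "integrable M (\<lambda>\<omega>. g \<omega> * ?W \<omega>)"
  proof (rule int[of _ "1 * (2 * X)"])
    have [measurable]: "Measurable.pred path_space (\<lambda>\<omega>. fst (fst (\<omega> (Suc t))) = s)" for s :: 's
      by (rule measurable_compose[OF measurable_path_state]) simp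
    show "?W \<in> borel_measurable path_space"
      unfolding state_value_sum pmf_mean_sum by measurable
    show "\<bar>?W \<omega>\<bar> \<le> 1 * (2 * X)" for \<omega>
    proof -
      have sv: "\<bar>state_value (Q t \<omega>) s\<bar> \<le> X" for s by (intro abs_state_value_le Q_bound)
      have "\<bar>pmf_mean (P i) (state_value (Q t \<omega>))\<bar> \<le> X" by (rule pmf_mean_abs_le) (rule sv)
      then show ?thesis
        unfolding abs_mult using visit_bounds[of i t \<omega>] sv[of "fst (fst (\<omega> (Suc t)))"] by (intro mult_mono) auto
    qed
  qed
  show ?thesis
    unfolding decomposed
    using j1 j2 j3 visits rewards transitions
    by (simp only: Bochner_Integration.integral_add Bochner_Integration.integrable_add integral_mult_right_zero integrable_mult_right)
qed

section \<open>The noise average and the pathwise error bound\<close>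

definition N :: "'s \<times> 'a \<Rightarrow> nat \<Rightarrow> (nat \<Rightarrow> ('s \<times> 'a) \<times> real) \<Rightarrow> real" where
  "N i t \<omega> = (\<Sum>k<t. step_weight \<sigma> \<alpha> t k * noise i k \<omega>)"

lemma N_Suc: "N i (Suc t) \<omega> = (1 - \<alpha> t * \<sigma>) * N i t \<omega> + \<alpha> t * noise i t \<omega>"
  unfolding N_def by (rule sum_step_weight_Suc)

lemma N_init: "t \<le> \<tau> \<Longrightarrow> N i t \<omega> = 0"
  unfolding N_def by (intro sum.neutral) (simp add: noise_def)

lemma measurable_N [measurable]: "N i t \<in> borel_measurable path_space"
  unfolding N_def[abs_def] by measurable

lemma N_tail:
  assumes X: "0 < X" and L: "0 < L"
  shows "M.prob {\<omega>. \<bar>N i t \<omega>\<bar> > 4 * X * sqrt (2 * real (\<tau> + 1) * (h / \<sigma>) * L) / sqrt (t + t\<^sub>0)} \<le> 2 * real (\<tau> + 1) * exp (- L)"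
proof -
  have "M.prob {\<omega>. \<bar>\<Sum>k<t. step_weight \<sigma> \<alpha> t k * noise i k \<omega>\<bar> > 4 * X * sqrt (2 * real (\<tau> + 1) * (h / \<sigma> / (t + t\<^sub>0)) * L)}
      \<le> 2 * real (\<tau> + 1) * exp (- L)"
  proof (rule shifted_azuma[where c = "4 * X" and e = "noise i" and \<tau> = \<tau>])
    show "(\<integral>\<omega>. g \<omega> * noise i k \<omega> \<partial>M) = 0"
      if "\<tau> \<le> k" "g \<in> borel_measurable path_space" "depends_before (Suc (k - \<tau>)) g" "\<And>\<omega>. \<bar>g \<omega>\<bar> \<le> B" for k g B
      using that by (rule noise_orthogonal)
    show "depends_before (k + 2) (noise i k)" for k by (rule depends_noise)
    show "(\<Sum>k<t. (step_weight \<sigma> \<alpha> t k)\<^sup>2) \<le> h / \<sigma> / (t + t\<^sub>0)"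
      unfolding \<alpha>_def[abs_def] by (rule sum_step_weight_square_le[OF \<sigma>_pos \<sigma>_le h_\<sigma> t0_h])
    show "0 < h / \<sigma> / (t + t\<^sub>0)" using h_pos \<sigma>_pos t0_pos by simp
  qed (use X L in \<open>simp_all add: noise_bound, simp_all add: noise_def\<close>)
  moreover have "sqrt (2 * real (\<tau> + 1) * (h / \<sigma> / (t + t\<^sub>0)) * L) = sqrt (2 * real (\<tau> + 1) * (h / \<sigma>) * L) / sqrt (t + t\<^sub>0)"
    by (simp add: real_sqrt_divide[symmetric])
  ultimately show ?thesis by (simp add: N_def)
qed

text \<open>A statement about a single path; probability enters only through \<open>good\<close>.
  The first condition on \<open>B\<close> is the one of \<open>envelope_step\<close> with the
  constant of \<open>lag_bound\<close>, and the lone \<open>m\<close> in the conclusion comes from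
  adding \<open>N\<close> back at the end.\<close>

lemma error_bound:
  fixes L :: real and T :: nat and B :: real
  defines "m \<equiv> 4 * X * sqrt (2 * real (\<tau> + 1) * (h / \<sigma>) * L)"
  assumes L: "0 < L"
    and B: "16 * X * \<tau> * h / (\<sigma> * (1 - \<gamma>)) \<le> B" "2 * X * (\<tau> + t\<^sub>0) \<le> B"
    and good: "\<And>t i. t \<le> T \<Longrightarrow> \<bar>N i t \<omega>\<bar> \<le> m / sqrt (t + t\<^sub>0)"
  shows "\<bar>Q T \<omega> $ i - Qs $ i\<bar> \<le> (4 * m / (1 - \<gamma>) + m) / sqrt (T + t\<^sub>0) + B / (T + t\<^sub>0)"
proof -
  define A where "A = 4 * m / (1 - \<gamma>)"
  define env where "env u = A / sqrt u + B / u" for u :: real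
  have m: "0 \<le> m" using X_nonneg h_pos \<sigma>_pos L by (simp add: m_def)
  have A0: "0 \<le> A" using m \<gamma>_less by (simp add: A_def)
  have dist: "\<bar>Q t \<omega> $ j - Qs $ j\<bar> \<le> 2 * X" for t j
    using Q_bound[of t \<omega> j] Qs_bound[of j] by linarith
  \<comment> \<open>Up to time \<open>\<tau>\<close> only the trivial bound \<open>2 * X\<close> is
    available. The second condition on \<open>B\<close> lets the envelope cover it, which starts the
    induction and settles horizons below \<open>\<tau>\<close>.\<close>
  have early: "2 * X \<le> B / (t + t\<^sub>0)" if "t \<le> \<tau>" for t :: nat
  proof -
    have "2 * X * (t + t\<^sub>0) \<le> 2 * X * (\<tau> + t\<^sub>0)" using that X_nonneg by (intro mult_left_mono) auto
    then show ?thesis using B(2) t0_pos by (simp add: pos_le_divide_eq)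
  qed
  \<comment> \<open>All coordinates are treated together, since \<open>F\<close> couples
    them.\<close>
  have main: "\<bar>Q t \<omega> $ j - Qs $ j - N j t \<omega>\<bar> \<le> env (t + t\<^sub>0)" if "\<tau> \<le> t" "t \<le> T" for t j
    using that
  proof (induction t arbitrary: j rule: dec_induct)
    case base
    then show ?case
      using dist[of \<tau> j] early[of \<tau>] A0 t0_pos by (simp add: N_init env_def add_increasing)
  next
    case (step t)
    define u where "u = t + t\<^sub>0"
    define n where "n = m / sqrt u"
    define \<Phi> where "\<Phi> = 8 * X * \<tau> * h"
    have u: "0 < u" using t0_pos by (simp add: u_def)
    have \<Phi>: "0 \<le> \<Phi>" using X_nonneg h_pos by (simp add: \<Phi>_def)
    have \<Phi>B: "2 * \<Phi> / (\<sigma> * (1 - \<gamma>)) \<le> B" using B(1) by (simp add: \<Phi>_def mult.assoc)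
    note env = envelope_step[OF u \<gamma>_nonneg \<gamma>_less \<sigma>_pos h_ge m A_def \<Phi>B \<Phi>, folded env_def n_def]
    define z where "z k = Q t \<omega> $ k - Qs $ k - N k t \<omega>" for k
    define d where "d = hit_prob j (t - \<tau>) \<omega>"
    have z: "\<bar>z k\<bar> \<le> env u" for k
      using step.IH[of k] step.prems by (simp add: z_def u_def)
    have N: "\<bar>N k t \<omega>\<bar> \<le> n" for k
      using good[of t k] step.prems by (simp add: n_def u_def)
    have "\<bar>Q t \<omega> $ k - Qs $ k\<bar> \<le> env u + n" for k
      using z[of k] N[of k] unfolding z_def by linarith
    then have F: "\<bar>F (Q t \<omega>) j - F Qs j\<bar> \<le> \<gamma> * (env u + n)"
      by (intro abs_bellman_diff_le \<gamma>_nonneg)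
    have "Q (Suc t) \<omega> $ j - Qs $ j - N j (Suc t) \<omega>
        = (z j + N j t \<omega> + \<alpha> t * (d * ((F (Q t \<omega>) j - F Qs j) - (z j + N j t \<omega>)) + noise j t \<omega> + lag j t \<omega>))
          - ((1 - \<alpha> t * \<sigma>) * N j t \<omega> + \<alpha> t * noise j t \<omega>)"
      using step.hyps by (simp add: Q_Suc_decomposed N_Suc z_def d_def H_def Qs)
    also have "\<bar>\<dots>\<bar> \<le> env u - \<alpha> t * \<sigma> * ((1 - \<gamma>) * env u - (1 + \<gamma>) * n) + \<alpha> t * (\<Phi> / u)"
    proof (rule error_step[OF z N F])
      show "\<bar>lag j t \<omega>\<bar> \<le> \<Phi> / u"
        using lag_bound[of t j \<omega>] step.hyps by (simp add: \<Phi>_def u_def)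
    qed (use hit_prob_bounds \<sigma>_pos \<alpha>_nonneg \<alpha>_le env(1) in \<open>auto simp: d_def less_imp_le\<close>)
    also have "\<dots> \<le> env (u + 1)"
      using env(2) by (simp add: \<alpha>_def u_def[symmetric])
    finally show ?case by (simp add: u_def add_ac)
  qed
  show ?thesis
  proof (cases "\<tau> \<le> T")
    case True
    have "\<bar>Q T \<omega> $ i - Qs $ i\<bar> \<le> env (T + t\<^sub>0) + m / sqrt (T + t\<^sub>0)"
      using main[OF True order_refl, of i] good[OF order_refl, of i] by linarith
    then show ?thesis by (simp add: env_def A_def add_divide_distrib)
  next
    case False
    have "0 \<le> (4 * m / (1 - \<gamma>) + m) / sqrt (T + t\<^sub>0)"
      using A0 m t0_pos by (simp add: A_def)
    then show ?thesis using dist[of T i] early[of T] False by linarith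
  qed
qed

text \<open>A union bound over all pairs and the times 1 to \<open>T\<close>: the recursion uses the
  noise bound at every earlier time. Time 0 costs nothing, because \<open>N\<close> vanishes
  there.\<close>

lemma high_probability_bound:
  fixes L :: real and T :: nat and B :: real
  defines "m \<equiv> 4 * X * sqrt (2 * real (\<tau> + 1) * (h / \<sigma>) * L)"
  assumes X: "0 < X" and L: "0 < L"
    and B: "16 * X * \<tau> * h / (\<sigma> * (1 - \<gamma>)) \<le> B" "2 * X * (\<tau> + t\<^sub>0) \<le> B"
  shows "M.prob {\<omega>. \<forall>i. \<bar>Q T \<omega> $ i - Qs $ i\<bar> \<le> (4 * m / (1 - \<gamma>) + m) / sqrt (T + t\<^sub>0) + B / (T + t\<^sub>0)}
    \<ge> 1 - T * CARD('s) * CARD('a) * (2 * real (\<tau> + 1) * exp (- L))"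
proof -
  define bad where "bad t i = {\<omega>. \<bar>N i t \<omega>\<bar> > m / sqrt (t + t\<^sub>0)}" for t i
  define Good where "Good = {\<omega>. \<forall>i. \<bar>Q T \<omega> $ i - Qs $ i\<bar> \<le> (4 * m / (1 - \<gamma>) + m) / sqrt (T + t\<^sub>0) + B / (T + t\<^sub>0)}"
  have m: "0 \<le> m" using X_nonneg h_pos \<sigma>_pos L by (simp add: m_def)
  have bad_sets: "bad t i \<in> M.events" for t i
  proof -
    have "{\<omega> \<in> space path_space. \<bar>N i t \<omega>\<bar> > m / sqrt (t + t\<^sub>0)} \<in> sets path_space" by measurable
    then show ?thesis by (simp add: bad_def sets_M)
  qed
  have Good_sets: "Good \<in> M.events"
  proof -
    have "{\<omega> \<in> space path_space. \<forall>i. \<bar>Q T \<omega> $ i - Qs $ i\<bar> \<le> (4 * m / (1 - \<gamma>) + m) / sqrt (T + t\<^sub>0) + B / (T + t\<^sub>0)} \<in> sets path_space"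
      by measurable
    then show ?thesis by (simp add: Good_def sets_M)
  qed
  have "UNIV - Good \<subseteq> (\<Union>ti\<in>{1..T} \<times> UNIV. bad (fst ti) (snd ti))"
  proof
    fix \<omega> assume "\<omega> \<in> UNIV - Good"
    show "\<omega> \<in> (\<Union>ti\<in>{1..T} \<times> UNIV. bad (fst ti) (snd ti))"
    proof (rule ccontr)
      assume not_bad: "\<not> ?thesis"
      have "\<bar>N i t \<omega>\<bar> \<le> m / sqrt (t + t\<^sub>0)" if "t \<le> T" for t i
      proof (cases "t = 0")
        case True
        then show ?thesis using m t0_pos by (simp add: N_init)
      next
        case False
        then have "(t, i) \<in> {1..T} \<times> UNIV" using that by simp
        then have "\<omega> \<notin> bad (fst (t, i)) (snd (t, i))" using not_bad by blast
        then have "\<omega> \<notin> bad t i" by simp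
        then show ?thesis by (simp add: bad_def)
      qed
      then have "\<omega> \<in> Good"
        unfolding Good_def m_def using error_bound[OF L B, of T \<omega>] by simp
      then show False using \<open>\<omega> \<in> UNIV - Good\<close> by simp
    qed
  qed
  then have "M.prob (UNIV - Good) \<le> M.prob (\<Union>ti\<in>{1..T} \<times> UNIV. bad (fst ti) (snd ti))"
    by (intro M.finite_measure_mono sets.finite_UN) (auto simp: bad_sets)
  also have "\<dots> \<le> (\<Sum>ti\<in>{1..T} \<times> UNIV. M.prob (bad (fst ti) (snd ti)))"
    by (intro M.finite_measure_subadditive_finite) (auto simp: bad_sets)
  also have "\<dots> \<le> (\<Sum>ti\<in>{1..T} \<times> (UNIV :: ('s \<times> 'a) set). 2 * real (\<tau> + 1) * exp (- L))"
    unfolding bad_def m_def by (intro sum_mono N_tail X L)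
  also have "\<dots> = T * CARD('s) * CARD('a) * (2 * real (\<tau> + 1) * exp (- L))"
    by (simp add: card_cartesian_product)
  finally show ?thesis
    using M.prob_compl[OF Good_sets] unfolding Good_def by simp
qed

end


section \<open>From the hypotheses of the theorem to its explicit constants\<close>

lemma power_ceiling_log_ge:
  fixes x :: real
  assumes "1 \<le> x"
  shows "x \<le> 2 ^ nat \<lceil>log 2 x\<rceil>"
proof -
  have "x = 2 powr log 2 x" using assms by simp
  also have "\<dots> \<le> 2 powr real (nat \<lceil>log 2 x\<rceil>)"
    by (intro powr_mono) linarith+
  finally show ?thesis by (simp add: powr_realpow)
qed

lemma infnorm_le_iff: "infnorm v \<le> c \<longleftrightarrow> (\<forall>i. \<bar>v $ i\<bar> \<le> c)" for v :: "real ^ 'n"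
proof
  assume "infnorm v \<le> c"
  then show "\<forall>i. \<bar>v $ i\<bar> \<le> c"
    using component_le_infnorm_cart[of v] order_trans by blast
next
  assume "\<forall>i. \<bar>v $ i\<bar> \<le> c"
  then show "infnorm v \<le> c"
    unfolding infnorm_cart by (intro cSup_least) auto
qed

text \<open>The bound is assumed along one trajectory law, whereas the Bellman operator involves
  every \<open>R x\<close>. Irreducibility gives each \<open>x\<close> a positive probability at
  some time, so a large reward at \<open>x\<close> could not go unseen.\<close>

lemma (in reward_chain) rewards_bounded_of_irreducible:
  assumes irr: "irreducible_chain K" and AE: "AE \<omega> in M. \<forall>t. \<bar>snd (\<omega> t)\<bar> \<le> b"
  shows "AE r in R x. \<bar>r\<bar> \<le> b"
proof -
  obtain y where y: "y \<in> set_pmf p" using set_pmf_not_empty[of p] by blast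
  obtain n where "pmf (nstep K n y) x > 0" using irr unfolding irreducible_chain_def by blast
  then have "x \<in> set_pmf (state_law n)"
    using y by (auto simp: state_law_def set_pmf_iff pmf_positive_iff)
  then show ?thesis
    by (intro reward_bounded_of_AE[OF AE, where t = n]) (simp add: pmf_positive_iff)
qed

context q_learning
begin

text \<open>Returns from clipped rewards to the actual ones: the two iterates agree almost
  surely.\<close>

lemma infnorm_bound:
  fixes rhs :: real
  assumes bounded: "AE \<omega> in M. \<forall>t. \<bar>snd (\<omega> t)\<bar> \<le> b"
    and prob: "c \<le> M.prob {\<omega>. \<forall>i. \<bar>Q T \<omega> $ i - Qs $ i\<bar> \<le> rhs}"
  shows "c \<le> M.prob {\<omega> \<in> space M. infnorm (q_iter \<gamma> \<alpha> \<omega> T - Qs) \<le> rhs}"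
proof -
  have "{\<omega> \<in> space path_space. \<forall>i. \<bar>q_iter \<gamma> \<alpha> \<omega> T $ i - Qs $ i\<bar> \<le> rhs} \<in> sets path_space"
    by measurable
  then have sets: "{\<omega> \<in> space M. infnorm (q_iter \<gamma> \<alpha> \<omega> T - Qs) \<le> rhs} \<in> M.events"
    by (simp add: infnorm_le_iff sets_M)
  have "AE \<omega> in M. q_iter \<gamma> \<alpha> \<omega> T = Q T \<omega>"
    using bounded
  proof eventually_elim
    case (elim \<omega>)
    then have "clipped \<omega> = \<omega>" by (auto simp: clipped_def clip_id)
    then show ?case by (simp add: Q_def)
  qed
  then have "M.prob {\<omega>. \<forall>i. \<bar>Q T \<omega> $ i - Qs $ i\<bar> \<le> rhs} \<le> M.prob {\<omega> \<in> space M. infnorm (q_iter \<gamma> \<alpha> \<omega> T - Qs) \<le> rhs}"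
    by (intro M.finite_measure_mono_AE[OF _ sets]) (auto simp: infnorm_le_iff elim!: eventually_mono)
  then show ?thesis using prob by linarith
qed

end

theorem theorem7:
  fixes P :: "('s::finite) \<times> ('a::finite) \<Rightarrow> 's pmf"
    and R :: "'s \<times> 'a \<Rightarrow> real measure"
    and \<gamma> r_bar h t\<^sub>0 \<mu>_min \<delta> :: real
    and \<pi> \<rho> :: "'s \<Rightarrow> 'a pmf"
    and \<iota> :: "'s pmf"
    and \<mu> :: "('s \<times> 'a) pmf"
    and t_mix T :: nat
  assumes "0 < \<gamma>" and "\<gamma> < 1"
    and reward_prob: "\<And>x. prob_space (R x)"
    and reward_sets: "\<And>x. sets (R x) = sets borel"
    and optimal: "optimal_policy P R \<gamma> \<rho>"
    and reward_bound: "AE \<omega> in traj_law R (sa_kernel P \<pi>) (with_action \<pi> \<iota>). \<forall>t. \<bar>snd (\<omega> t)\<bar> \<le> r_bar"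
    and ergodic: "ergodic_chain (sa_kernel P \<pi>)"
    and stationary: "stationary (sa_kernel P \<pi>) \<mu>"
    and mixing: "is_mixing_time (sa_kernel P \<pi>) \<mu> t_mix"
    and \<mu>_min: "\<mu>_min = (INF x. pmf \<mu> x)"
    and "\<mu>_min > 0"
    and "t\<^sub>0 \<ge> max (4 * h) (\<lceil>log 2 (2 / \<mu>_min)\<rceil> * t_mix)"
    and "h \<ge> 4 / (\<mu>_min * (1 - \<gamma>))"
    and "T \<ge> 1"
    and "0 < \<delta>" and "\<delta> < 1"
  shows "\<P>(\<omega> in traj_law R (sa_kernel P \<pi>) (with_action \<pi> \<iota>).
           infnorm (q_iter \<gamma> (\<lambda>t. h / (t + t\<^sub>0)) \<omega> T - q_fun P R \<gamma> \<rho>)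
           \<le> 60 * r_bar / (1 - \<gamma>)\<^sup>2
               * sqrt (2 * (\<lceil>log 2 (2 / \<mu>_min)\<rceil> * t_mix + 1) * h / \<mu>_min)
               * sqrt (ln (2 * (\<lceil>log 2 (2 / \<mu>_min)\<rceil> * t_mix + 1) * T\<^sup>2 * CARD('s) * CARD('a) / \<delta>) / (T + t\<^sub>0))
             + 4 * r_bar / (1 - \<gamma>)\<^sup>2
               * max (160 * h * \<lceil>log 2 (2 / \<mu>_min)\<rceil> * t_mix / \<mu>_min)
                     (2 * (\<lceil>log 2 (2 / \<mu>_min)\<rceil> * t_mix + t\<^sub>0))
               * (1 / (T + t\<^sub>0)))
         \<ge> 1 - \<delta>"
proof -
  define k where "k = nat \<lceil>log 2 (2 / \<mu>_min)\<rceil>"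
  define \<tau> where "\<tau> = k * t_mix"
  \<comment> \<open>After \<open>k\<close> mixing times the error is at most
    \<open>1 / 2 ^ k \<le> \<mu>_min / 2\<close>, so half of the stationary mass is left.\<close>
  define \<sigma> where "\<sigma> = \<mu>_min / 2"
  have \<mu>_min_le: "\<mu>_min \<le> pmf \<mu> x" for x
    unfolding \<mu>_min by (intro cINF_lower) auto
  have \<mu>_min_1: "\<mu>_min \<le> 1"
    using \<mu>_min_le[of undefined] pmf_le_1[of \<mu> undefined] by linarith
  have log_ge: "1 \<le> log 2 (2 / \<mu>_min)"
    using \<open>\<mu>_min > 0\<close> \<mu>_min_1 by (simp add: le_log_iff pos_le_divide_eq)
  have k: "1 \<le> k" and ceil: "\<lceil>log 2 (2 / \<mu>_min)\<rceil> = int k"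
    using log_ge by (auto simp: k_def le_nat_iff)
  have t_mix: "0 < t_mix" and mixed: "mixed_at (sa_kernel P \<pi>) \<mu> t_mix"
    using mixing by (auto simp: is_mixing_time_def)
  have \<tau>_pos: "1 \<le> \<tau>" using k t_mix by (simp add: \<tau>_def)
  have "2 / \<mu>_min \<le> 2 ^ k"
    unfolding k_def using \<open>\<mu>_min > 0\<close> \<mu>_min_1 by (intro power_ceiling_log_ge) (simp add: pos_le_divide_eq)
  then have "1 / 2 ^ k \<le> \<mu>_min / 2"
    using \<open>\<mu>_min > 0\<close> by (simp add: field_simps)
  then have hit: "\<sigma> \<le> pmf (nstep (sa_kernel P \<pi>) \<tau> x) i" for x i
    using nstep_lower_bound[OF mixed stationary, of i k x] \<mu>_min_le[of i] unfolding \<sigma>_def \<tau>_def by linarith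

  interpret chain: reward_chain R "sa_kernel P \<pi>" "with_action \<pi> \<iota>"
    by (rule reward_chain.intro) (rule reward_prob reward_sets)+
  have r_bar: "0 \<le> r_bar"
  proof (rule ccontr)
    assume "\<not> ?thesis"
    then have neg: "\<not> \<bar>snd (\<omega> 0)\<bar> \<le> r_bar" for \<omega> :: "nat \<Rightarrow> ('s \<times> 'a) \<times> real"
      by linarith
    have "AE \<omega> in chain.M. False"
      using reward_bound by eventually_elim (use neg in blast)
    then show False by simp
  qed
  have R_bounded: "AE r in R x. \<bar>r\<bar> \<le> r_bar" for x
    using ergodic reward_bound by (intro chain.rewards_bounded_of_irreducible) (auto simp: ergodic_chain_def)
  interpret bounded_mdp P R \<gamma> r_bar
    by (rule bounded_mdp.intro) (use assms r_bar R_bounded in auto)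
  interpret q_learning P R \<gamma> r_bar \<pi> \<iota> \<sigma> h t\<^sub>0 \<tau> "q_fun P R \<gamma> \<rho>"
  proof unfold_locales
    show "\<sigma> \<le> pmf (nstep (sa_kernel P \<pi>) \<tau> x) i" for x i by (rule hit)
    show "0 < \<sigma>" using \<open>\<mu>_min > 0\<close> by (simp add: \<sigma>_def)
    show "1 \<le> \<tau>" by (rule \<tau>_pos)
    show "4 * h \<le> t\<^sub>0" using assms by simp
    show "\<tau> \<le> t\<^sub>0" using \<open>t\<^sub>0 \<ge> max _ _\<close> unfolding ceil by (simp add: \<tau>_def)
    show "2 / (\<sigma> * (1 - \<gamma>)) \<le> h" using \<open>h \<ge> 4 / _\<close> by (simp add: \<sigma>_def)
    show "bellman P (reward_mean R) \<gamma> (q_fun P R \<gamma> \<rho>) x = q_fun P R \<gamma> \<rho> $ x" for x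
      by (rule optimal_fixed_point[OF optimal])
  qed

  define g where "g = 1 - \<gamma>"
  have g: "0 < g" "g \<le> 1" using \<open>0 < \<gamma>\<close> \<open>\<gamma> < 1\<close> by (auto simp: g_def)
  \<comment> \<open>The union bound would need only the first power of \<open>T\<close>; with the
    square, the failure probability comes out as \<open>\<delta> / T\<close>.\<close>
  define C where "C = 2 * real (\<tau> + 1) * (real T)\<^sup>2 * real CARD('s) * real CARD('a)"
  define L where "L = ln (C / \<delta>)"
  define B where "B = 4 * r_bar / g\<^sup>2 * max (160 * h * \<tau> / \<mu>_min) (2 * (\<tau> + t\<^sub>0))"
  define rhs where "rhs = 60 * r_bar / g\<^sup>2 * sqrt (2 * real (\<tau> + 1) * h / \<mu>_min) * sqrt (L / (T + t\<^sub>0)) + B / (T + t\<^sub>0)"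
  have T: "1 \<le> real T" using \<open>T \<ge> 1\<close> by simp
  have C: "1 \<le> C"
  proof -
    have "1 \<le> CARD('s)" "1 \<le> CARD('a)" using zero_less_card_finite[where 'a = 's] zero_less_card_finite[where 'a = 'a] by linarith+
    then have "1 \<le> 2 * (\<tau> + 1) * T\<^sup>2 * CARD('s) * CARD('a)" using \<open>T \<ge> 1\<close> by (simp add: Suc_le_eq)
    then have "real 1 \<le> real (2 * (\<tau> + 1) * T\<^sup>2 * CARD('s) * CARD('a))" by (simp only: of_nat_le_iff)
    then show ?thesis by (simp add: C_def algebra_simps)
  qed
  have C\<delta>: "1 < C / \<delta>" using C \<open>0 < \<delta>\<close> \<open>\<delta> < 1\<close> by (simp add: pos_less_divide_eq)
  then have L: "0 < L" by (simp add: L_def)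
  have "1 - \<delta> \<le> chain.M.prob {\<omega>. \<forall>i. \<bar>Q T \<omega> $ i - q_fun P R \<gamma> \<rho> $ i\<bar> \<le> rhs}"
  \<comment> \<open>The concentration bound needs a positive noise bound \<open>4 * X\<close>. For
    \<open>r_bar = 0\<close> the iterates and the optimal table are both zero.\<close>
  proof (cases "r_bar = 0")
    case True
    then have "X = 0" unfolding X_def by simp
    then have "\<bar>Q T \<omega> $ i - q_fun P R \<gamma> \<rho> $ i\<bar> \<le> rhs" for \<omega> i
      using Q_bound[of T \<omega> i] Qs_bound[of i] True by (simp add: rhs_def B_def)
    then have "{\<omega>. \<forall>i. \<bar>Q T \<omega> $ i - q_fun P R \<gamma> \<rho> $ i\<bar> \<le> rhs} = UNIV" by blast
    then show ?thesis using \<open>0 < \<delta>\<close> by simp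
  next
    case False
    then have X: "0 < X" using r_bar g by (simp add: X_def g_def)
    define m where "m = 4 * X * sqrt (2 * real (\<tau> + 1) * (h / \<sigma>) * L)"
    have X_le: "X \<le> r_bar / g\<^sup>2"
      using g r_bar by (simp add: X_def g_def[symmetric] power2_eq_square field_simps mult_left_le_one_le)
    \<comment> \<open>The lag requires the factor 32, while the stated bound offers
      \<open>4 * 160 = 640\<close>.\<close>
    have B1: "16 * X * \<tau> * h / (\<sigma> * (1 - \<gamma>)) \<le> B"
    proof -
      have "16 * X * \<tau> * h / (\<sigma> * (1 - \<gamma>)) = r_bar / g\<^sup>2 * (32 * (h * \<tau> / \<mu>_min))"
        by (simp add: X_def g_def[symmetric] \<sigma>_def power2_eq_square mult_ac)
      also have "\<dots> \<le> r_bar / g\<^sup>2 * (640 * (h * \<tau> / \<mu>_min))"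
        using r_bar h_pos \<open>\<mu>_min > 0\<close> by (intro mult_left_mono mult_right_mono) auto
      also have "\<dots> = 4 * r_bar / g\<^sup>2 * (160 * h * \<tau> / \<mu>_min)" by simp
      also have "\<dots> \<le> B" unfolding B_def using r_bar by (intro mult_left_mono) auto
      finally show ?thesis .
    qed
    have B2: "2 * X * (\<tau> + t\<^sub>0) \<le> B"
    proof -
      have "2 * X * (\<tau> + t\<^sub>0) \<le> 8 * (r_bar / g\<^sup>2) * (\<tau> + t\<^sub>0)"
        using X_le X t0_pos by (intro mult_right_mono) auto
      also have "\<dots> = 4 * r_bar / g\<^sup>2 * (2 * (\<tau> + t\<^sub>0))" by simp
      also have "\<dots> \<le> B" unfolding B_def using r_bar by (intro mult_left_mono) auto
      finally show ?thesis .
    qed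
    \<comment> \<open>Replacing \<open>\<sigma>\<close> by \<open>\<mu>_min / 2\<close> costs
      \<open>sqrt 2 \<le> 2\<close>, so \<open>m \<le> 8 * X * w\<close>. Adding \<open>m\<close> to
      \<open>4 * m / g\<close> gives at most \<open>5 * m / g\<close>, so the factor is 40, below
      the stated 60.\<close>
    have first_term: "(4 * m / (1 - \<gamma>) + m) / sqrt (T + t\<^sub>0)
        \<le> 60 * r_bar / g\<^sup>2 * sqrt (2 * real (\<tau> + 1) * h / \<mu>_min) * sqrt (L / (T + t\<^sub>0))"
    proof -
      define w where "w = sqrt (2 * real (\<tau> + 1) * h / \<mu>_min) * sqrt L"
      have w: "0 \<le> w" using h_pos \<open>\<mu>_min > 0\<close> L by (simp add: w_def)
      have "sqrt (2 * real (\<tau> + 1) * (h / \<sigma>) * L) = sqrt 2 * w"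
        by (simp add: w_def \<sigma>_def real_sqrt_mult[symmetric] add_divide_distrib algebra_simps)
      also have "\<dots> \<le> 2 * w"
        using w by (intro mult_right_mono real_le_lsqrt) auto
      finally have m: "m \<le> 8 * X * w" using X by (simp add: m_def)
      have m0: "0 \<le> m" using X h_pos \<open>\<mu>_min > 0\<close> L by (simp add: m_def \<sigma>_def)
      have "m \<le> m / g" using m0 g by (simp add: pos_le_divide_eq mult_left_le)
      then have "4 * m / (1 - \<gamma>) + m \<le> 5 * m / g" by (simp add: g_def[symmetric])
      also have "\<dots> \<le> 5 * (8 * X * w) / g" using m g by (intro divide_right_mono mult_left_mono) auto
      also have "\<dots> = 40 * (r_bar / g\<^sup>2 * w)" by (simp add: X_def g_def[symmetric] power2_eq_square)
      also have "\<dots> \<le> 60 * (r_bar / g\<^sup>2 * w)" using r_bar w by (intro mult_right_mono) auto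
      finally have "(4 * m / (1 - \<gamma>) + m) / sqrt (T + t\<^sub>0) \<le> 60 * (r_bar / g\<^sup>2 * w) / sqrt (T + t\<^sub>0)"
        using t0_pos by (intro divide_right_mono) auto
      then show ?thesis by (simp add: w_def real_sqrt_divide)
    qed
    have exp_L: "exp (- L) = \<delta> / C"
      using C\<delta> C \<open>0 < \<delta>\<close> by (simp add: L_def exp_minus)
    have "T * CARD('s) * CARD('a) * (2 * real (\<tau> + 1) * exp (- L)) = \<delta> / T"
      using C T unfolding exp_L C_def by (simp add: power2_eq_square)
    also have "\<dots> \<le> \<delta>" using T \<open>0 < \<delta>\<close> by (simp add: divide_le_eq mult_left_le)
    finally have "1 - \<delta> \<le> chain.M.prob {\<omega>. \<forall>i. \<bar>Q T \<omega> $ i - q_fun P R \<gamma> \<rho> $ i\<bar> \<le> (4 * m / (1 - \<gamma>) + m) / sqrt (T + t\<^sub>0) + B / (T + t\<^sub>0)}"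
      using high_probability_bound[OF X L B1 B2, of T] unfolding m_def by linarith
    also have "\<dots> \<le> chain.M.prob {\<omega>. \<forall>i. \<bar>Q T \<omega> $ i - q_fun P R \<gamma> \<rho> $ i\<bar> \<le> rhs}"
    proof (rule chain.M.finite_measure_mono)
      have "(4 * m / (1 - \<gamma>) + m) / sqrt (T + t\<^sub>0) + B / (T + t\<^sub>0) \<le> rhs"
        unfolding rhs_def by (rule add_right_mono[OF first_term])
      then show "{\<omega>. \<forall>i. \<bar>Q T \<omega> $ i - q_fun P R \<gamma> \<rho> $ i\<bar> \<le> (4 * m / (1 - \<gamma>) + m) / sqrt (T + t\<^sub>0) + B / (T + t\<^sub>0)}
          \<subseteq> {\<omega>. \<forall>i. \<bar>Q T \<omega> $ i - q_fun P R \<gamma> \<rho> $ i\<bar> \<le> rhs}"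
        using order_trans by blast
      have "{\<omega> \<in> space path_space. \<forall>i. \<bar>Q T \<omega> $ i - q_fun P R \<gamma> \<rho> $ i\<bar> \<le> rhs} \<in> sets path_space" by measurable
      then show "{\<omega>. \<forall>i. \<bar>Q T \<omega> $ i - q_fun P R \<gamma> \<rho> $ i\<bar> \<le> rhs} \<in> chain.M.events" by (simp add: chain.sets_M)
    qed
    finally show ?thesis .
  qed
  then have "1 - \<delta> \<le> chain.M.prob {\<omega> \<in> space chain.M. infnorm (q_iter \<gamma> \<alpha> \<omega> T - q_fun P R \<gamma> \<rho>) \<le> rhs}"
    by (rule infnorm_bound[OF reward_bound])
  then show ?thesis
    unfolding ceil by (simp add: \<alpha>_def[abs_def] rhs_def B_def L_def C_def g_def \<tau>_def add_ac mult.assoc)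
qed

end
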